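(* Let $(\Omega,\mathcal F,\mu)$ be a probability space. The couple $$\big(U^1_1(\Omega^\infty,L^1(\mathbb R)),\ U^2_1(\Omega^\infty,L^2(\mathbb R))\big)$$ is $K$-closed in $$\big(L^1(\Omega^\infty,L^1(\mathbb R)),\ L^2(\Omega^\infty,L^2(\mathbb R))\big).$$
   Context: $\Omega^\infty=\Omega^{\mathbb N}$ carries the product probability measure. $U^2_{\le m}(\Omega^\infty)\subset L^2(\Omega^\infty)$ is the closed span of the functions in $L^2(\Omega^\infty)$ depending on at most $m$ coordinates, and $U^2_1=U^2_{\le1}\cap(U^2_{\le0})^\perp$ (i.e. the closed span of mean-zero functions of a single coordinate); $U^1_1(\Omega^\infty)$ is the closure of $U^2_1$ in $L^1(\Omega^\infty)$. For $p\in\{1,2\}$ and a Banach space $B$, $U^p_1(\Omega^\infty,B)$ is the closure of $U^p_1(\Omega^\infty)\otimes B$ in the Bochner space $L^p(\Omega^\infty,B)$. For a compatible couple $(X_0,X_1)$ of Banach spaces, $K(f,t;X_0,X_1)=\inf_{f=f_0+f_1}\|f_0\|_{X_0}+t\|f_1\|_{X_1}$ for $f\in X_0+X_1$, $t>0$. For closed subspaces $Y_0\subset X_0$, $Y_1\subset X_1$ (with inherited norms), $(Y_0,Y_1)$ is $K$-closed in $(X_0,X_1)$ if there is a constant $C$ with $K(f,t;Y_0,Y_1)\le C\,K(f,t;X_0,X_1)$ for all $f\in Y_0+Y_1$ and $t>0$. Here all spaces are regarded inside the measurable functions on $\Omega^\infty\times\mathbb R$. *)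

theory Defs
  imports "HOL-Probability.Probability" "HOL-Library.Function_Algebras"
begin

text \<open>
  The scalars are a type \<open>'k\<close> of class \<open>{real_normed_field, euclidean_space}\<close>, so that
  \<open>real\<close> and \<open>complex\<close> are treated simultaneously.

  Elements of $L^p$-type spaces are represented by measurable functions, not by classes modulo
  null sets, and the norms of the quotients appear as seminorms.  All spaces below (see
  \<open>closure_in_Bochner_AE_cong\<close>) are invariant under modification on null sets within the
  measurable functions, so that pointwise decompositions \<open>f = f0 + f1\<close> of
  representatives amount to decompositions of the classes.
\<close>

interpretation fun_space:
  vector_space "\<lambda>(c::'k::field) (f::'a \<Rightarrow> 'k) x. c * f x"
  by unfold_locales (auto simp: fun_eq_iff algebra_simps)

definition Lp_norm :: "'a measure \<Rightarrow> real \<Rightarrow> ('a \<Rightarrow> 'k::{banach, second_countable_topology}) \<Rightarrow> real" where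
  "Lp_norm M p f = (\<integral>x. norm (f x) powr p \<partial>M) powr (1 / p)"

definition Lp :: "'a measure \<Rightarrow> real \<Rightarrow> ('a \<Rightarrow> 'k::{banach, second_countable_topology}) set" where
  "Lp M p = {f \<in> borel_measurable M. integrable M (\<lambda>x. norm (f x) powr p)}"

text \<open>
  The Bochner space $L^p(P, L^p(N))$, realised as a space of jointly measurable functions: \<open>f\<close>
  stands for the vector-valued function sending \<open>\<omega>\<close> to \<open>f (\<omega>, _)\<close>.
\<close>

definition Bochner_norm ::
  "'a measure \<Rightarrow> 'b measure \<Rightarrow> real \<Rightarrow> ('a \<times> 'b \<Rightarrow> 'k::{banach, second_countable_topology}) \<Rightarrow> real" where
  "Bochner_norm P N p f = Lp_norm P p (\<lambda>\<omega>. Lp_norm N p (\<lambda>x. f (\<omega>, x)))"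

definition Bochner ::
  "'a measure \<Rightarrow> 'b measure \<Rightarrow> real \<Rightarrow> ('a \<times> 'b \<Rightarrow> 'k::{banach, second_countable_topology}) set" where
  "Bochner P N p =
    {f \<in> borel_measurable (P \<Otimes>\<^sub>M N).
       (AE \<omega> in P. (\<lambda>x. f (\<omega>, x)) \<in> Lp N p) \<and>
       (\<lambda>\<omega>. Lp_norm N p (\<lambda>x. f (\<omega>, x))) \<in> Lp P p}"

definition closure_in :: "'v::ab_group_add set \<Rightarrow> ('v \<Rightarrow> real) \<Rightarrow> 'v set \<Rightarrow> 'v set" where
  "closure_in X n A = {f \<in> X. \<forall>e>0. \<exists>g\<in>A. n (f - g) < e}"

abbreviation infinite_power :: "'a measure \<Rightarrow> (nat \<Rightarrow> 'a) measure" where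
  "infinite_power M \<equiv> \<Pi>\<^sub>M i\<in>(UNIV::nat set). M"

definition depends_on :: "'a measure \<Rightarrow> nat set \<Rightarrow> ((nat \<Rightarrow> 'a) \<Rightarrow> 'k) \<Rightarrow> bool" where
  "depends_on M J f \<longleftrightarrow>
    (\<forall>\<omega>\<in>space (infinite_power M). \<forall>\<omega>'\<in>space (infinite_power M).
       (\<forall>j\<in>J. \<omega> j = \<omega>' j) \<longrightarrow> f \<omega> = f \<omega>')"

definition U2_le :: "'a measure \<Rightarrow> nat \<Rightarrow> ((nat \<Rightarrow> 'a) \<Rightarrow> 'k::{real_normed_field, euclidean_space}) set" where
  "U2_le M m =
    closure_in (Lp (infinite_power M) 2) (Lp_norm (infinite_power M) 2)
      (fun_space.span
        {f \<in> Lp (infinite_power M) 2. \<exists>J. finite J \<and> card J \<le> m \<and> depends_on M J f})"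

text \<open>
  For complex scalars \<open>inner\<close> is the real part of the Hermitian product; for a complex
  subspace \<open>U\<close>, such as every \<open>U2_le M m\<close>, this gives the same orthogonal complement.
\<close>

definition orth_complement ::
  "'a measure \<Rightarrow> ('a \<Rightarrow> 'k::euclidean_space) set \<Rightarrow> ('a \<Rightarrow> 'k) set" where
  "orth_complement P U = {f \<in> Lp P 2. \<forall>g\<in>U. (\<integral>\<omega>. inner (f \<omega>) (g \<omega>) \<partial>P) = 0}"

definition U2_1 :: "'a measure \<Rightarrow> ((nat \<Rightarrow> 'a) \<Rightarrow> 'k::{real_normed_field, euclidean_space}) set" where
  "U2_1 M = U2_le M 1 \<inter> orth_complement (infinite_power M) (U2_le M 0)"

definition U1_1 :: "'a measure \<Rightarrow> ((nat \<Rightarrow> 'a) \<Rightarrow> 'k::{real_normed_field, euclidean_space}) set" where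
  "U1_1 M = closure_in (Lp (infinite_power M) 1) (Lp_norm (infinite_power M) 1) (U2_1 M)"

definition tensor :: "('a \<Rightarrow> 'k::field) set \<Rightarrow> ('b \<Rightarrow> 'k) set \<Rightarrow> ('a \<times> 'b \<Rightarrow> 'k) set" where
  "tensor U B = fun_space.span {(\<lambda>(\<omega>, x). u \<omega> * b x) | u b. u \<in> U \<and> b \<in> B}"

definition U2_1_vec ::
  "'a measure \<Rightarrow> 'b measure \<Rightarrow> ((nat \<Rightarrow> 'a) \<times> 'b \<Rightarrow> 'k::{real_normed_field, euclidean_space}) set" where
  "U2_1_vec M N =
    closure_in (Bochner (infinite_power M) N 2) (Bochner_norm (infinite_power M) N 2)
      (tensor (U2_1 M) (Lp N 2))"

definition U1_1_vec ::
  "'a measure \<Rightarrow> 'b measure \<Rightarrow> ((nat \<Rightarrow> 'a) \<times> 'b \<Rightarrow> 'k::{real_normed_field, euclidean_space}) set" where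
  "U1_1_vec M N =
    closure_in (Bochner (infinite_power M) N 1) (Bochner_norm (infinite_power M) N 1)
      (tensor (U1_1 M) (Lp N 1))"

definition K_functional ::
  "'v::ab_group_add set \<Rightarrow> ('v \<Rightarrow> real) \<Rightarrow> 'v set \<Rightarrow> ('v \<Rightarrow> real) \<Rightarrow> 'v \<Rightarrow> real \<Rightarrow> real" where
  "K_functional X0 n0 X1 n1 f t =
    Inf {n0 f0 + t * n1 f1 | f0 f1. f0 \<in> X0 \<and> f1 \<in> X1 \<and> f = f0 + f1}"

text \<open>
  The definition is meant for closed subspaces \<open>Y0 \<subseteq> X0\<close> and \<open>Y1 \<subseteq> X1\<close>; they carry the
  (semi)norms of \<open>X0\<close> and \<open>X1\<close>.
\<close>

definition K_closed ::
  "'v::ab_group_add set \<Rightarrow> 'v set \<Rightarrow> 'v set \<Rightarrow> ('v \<Rightarrow> real) \<Rightarrow> 'v set \<Rightarrow> ('v \<Rightarrow> real) \<Rightarrow> bool" where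
  "K_closed Y0 Y1 X0 n0 X1 n1 \<longleftrightarrow>
    (\<exists>C. \<forall>f0\<in>Y0. \<forall>f1\<in>Y1. \<forall>t>0.
       K_functional Y0 n0 Y1 n1 (f0 + f1) t \<le> C * K_functional X0 n0 X1 n1 (f0 + f1) t)"

lemma Lp_norm_cong_AE:
  assumes "f \<in> borel_measurable M" "g \<in> borel_measurable M" "AE x in M. f x = g x"
  shows "Lp_norm M p f = Lp_norm M p g"
  unfolding Lp_norm_def using assms
  by (intro arg_cong[where f = "\<lambda>z. z powr (1 / p)"] integral_cong_AE) auto

lemma Lp_cong_AE:
  assumes "f \<in> Lp M p" "g \<in> borel_measurable M" "AE x in M. f x = g x"
  shows "g \<in> Lp M p"
proof -
  have "integrable M (\<lambda>x. norm (f x) powr p) \<longleftrightarrow> integrable M (\<lambda>x. norm (g x) powr p)"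
    using assms by (intro integrable_cong_AE) (auto simp: Lp_def)
  then show ?thesis using assms by (simp add: Lp_def)
qed

lemma measurable_section_norm:
  fixes f :: "'a \<times> 'b \<Rightarrow> 'k::{banach, second_countable_topology}"
  assumes "sigma_finite_measure N" and [measurable]: "f \<in> borel_measurable (P \<Otimes>\<^sub>M N)"
  shows "(\<lambda>\<omega>. Lp_norm N p (\<lambda>x. f (\<omega>, x))) \<in> borel_measurable P"
proof -
  interpret sigma_finite_measure N by fact
  show ?thesis unfolding Lp_norm_def by measurable
qed

lemma AE_sections:
  fixes f g :: "'a \<times> 'b \<Rightarrow> 'k::{banach, second_countable_topology}"
  assumes "sigma_finite_measure P" "sigma_finite_measure N"
    and [measurable]: "f \<in> borel_measurable (P \<Otimes>\<^sub>M N)" "g \<in> borel_measurable (P \<Otimes>\<^sub>M N)"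
    and "AE z in P \<Otimes>\<^sub>M N. f z = g z"
  shows "AE \<omega> in P. (\<lambda>x. f (\<omega>, x)) \<in> borel_measurable N \<and> (\<lambda>x. g (\<omega>, x)) \<in> borel_measurable N \<and>
           (AE x in N. f (\<omega>, x) = g (\<omega>, x))"
proof -
  interpret pair_sigma_finite P N using assms by (simp add: pair_sigma_finite_def)
  have "AE \<omega> in P. AE x in N. f (\<omega>, x) = g (\<omega>, x)"
    using AE_pair[OF assms(5)] by simp
  then show ?thesis by (rule AE_mp) (auto intro!: AE_I2)
qed

lemma Bochner_norm_cong_AE:
  fixes f g :: "'a \<times> 'b \<Rightarrow> 'k::{banach, second_countable_topology}"
  assumes "sigma_finite_measure P" "sigma_finite_measure N"
    and "f \<in> borel_measurable (P \<Otimes>\<^sub>M N)" "g \<in> borel_measurable (P \<Otimes>\<^sub>M N)"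
    and "AE z in P \<Otimes>\<^sub>M N. f z = g z"
  shows "Bochner_norm P N p f = Bochner_norm P N p g"
proof -
  have "AE \<omega> in P. Lp_norm N p (\<lambda>x. f (\<omega>, x)) = Lp_norm N p (\<lambda>x. g (\<omega>, x))"
    using AE_sections[OF assms] by (rule AE_mp) (auto intro!: AE_I2 Lp_norm_cong_AE)
  then show ?thesis unfolding Bochner_norm_def
    by (intro Lp_norm_cong_AE measurable_section_norm assms)
qed

lemma Bochner_cong_AE:
  fixes f g :: "'a \<times> 'b \<Rightarrow> 'k::{banach, second_countable_topology}"
  assumes "sigma_finite_measure P" "sigma_finite_measure N"
    and "f \<in> Bochner P N p" "g \<in> borel_measurable (P \<Otimes>\<^sub>M N)"
    and "AE z in P \<Otimes>\<^sub>M N. f z = g z"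
  shows "g \<in> Bochner P N p"
proof -
  have f: "f \<in> borel_measurable (P \<Otimes>\<^sub>M N)" and fL: "AE \<omega> in P. (\<lambda>x. f (\<omega>, x)) \<in> Lp N p"
    and fn: "(\<lambda>\<omega>. Lp_norm N p (\<lambda>x. f (\<omega>, x))) \<in> Lp P p"
    using assms(3) by (auto simp: Bochner_def)
  note sec = AE_sections[OF assms(1,2) f assms(4,5)]
  have "AE \<omega> in P. (\<lambda>x. g (\<omega>, x)) \<in> Lp N p"
    using sec fL by eventually_elim (auto intro: Lp_cong_AE)
  moreover have "AE \<omega> in P. Lp_norm N p (\<lambda>x. f (\<omega>, x)) = Lp_norm N p (\<lambda>x. g (\<omega>, x))"
    using sec by eventually_elim (auto intro!: Lp_norm_cong_AE)
  then have "(\<lambda>\<omega>. Lp_norm N p (\<lambda>x. g (\<omega>, x))) \<in> Lp P p"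
    by (rule Lp_cong_AE[OF fn measurable_section_norm[OF assms(2,4)]])
  ultimately show ?thesis using assms(4) by (simp add: Bochner_def)
qed

lemma closure_in_Bochner_AE_cong:
  fixes f g :: "'a \<times> 'b \<Rightarrow> 'k::{banach, second_countable_topology}"
  assumes "sigma_finite_measure P" "sigma_finite_measure N"
    and A: "A \<subseteq> borel_measurable (P \<Otimes>\<^sub>M N)"
    and f: "f \<in> closure_in (Bochner P N p) (Bochner_norm P N p) A"
    and g: "g \<in> borel_measurable (P \<Otimes>\<^sub>M N)"
    and eq: "AE z in P \<Otimes>\<^sub>M N. f z = g z"
  shows "g \<in> closure_in (Bochner P N p) (Bochner_norm P N p) A"
proof -
  have fB: "f \<in> Bochner P N p" using f by (simp add: closure_in_def)
  then have fm: "f \<in> borel_measurable (P \<Otimes>\<^sub>M N)" by (simp add: Bochner_def)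
  have "Bochner_norm P N p (f - h) = Bochner_norm P N p (g - h)" if "h \<in> A" for h
  proof (rule Bochner_norm_cong_AE[OF assms(1,2)])
    have hm: "h \<in> borel_measurable (P \<Otimes>\<^sub>M N)" using that A by blast
    show "f - h \<in> borel_measurable (P \<Otimes>\<^sub>M N)" "g - h \<in> borel_measurable (P \<Otimes>\<^sub>M N)"
      using fm g hm by (auto simp: fun_diff_def)
    show "AE z in P \<Otimes>\<^sub>M N. (f - h) z = (g - h) z"
      using eq by eventually_elim simp
  qed
  then show ?thesis
    using f Bochner_cong_AE[OF assms(1,2) fB g eq] by (auto simp: closure_in_def)
qed

end

theory Submission
  imports Defs
begin

text \<open>
  Instead of the \<open>K\<close>-functional, consider for fixed \<open>r > 0\<close> the infimum of
  \<open>\<parallel>g\<parallel>\<^sub>1 + \<parallel>h\<parallel>\<^sub>2\<^sup>2 / r\<close> over the decompositions \<open>f = g + h\<close>. Both summands are integrals, so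
  this functional can be treated separately at each point \<open>x\<close> of the real line; choosing
  \<open>r\<close> of the order of \<open>\<parallel>h\<parallel>\<^sub>2 / t\<close> afterwards turns a bound for it into a bound for \<open>K(f, t)\<close>
  (\<open>K_functional_closure_simple_sections\<close>). At a fixed \<open>x\<close> the problem concerns one scalar sum
  \<open>F(\<omega>) = \<Sum>\<^sub>k w\<^sub>k(\<omega>\<^sub>k)\<close> of independent mean-zero terms and is solved by
  \<open>first_order_decomposition\<close>, with the constant 32.

  For the scalar problem let \<open>u\<^sub>k\<close> be \<open>w\<^sub>k\<close> truncated radially at level \<open>r\<close>, and put
  \<open>D = \<Sum>\<^sub>k E(|w\<^sub>k| min(|w\<^sub>k|, r))\<close> and \<open>V = \<Sum>\<^sub>k E(min(|w\<^sub>k|, r)\<^sup>2)\<close>, so that \<open>V \<le> D\<close>. The sums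
  \<open>B\<close> of the centred \<open>u\<^sub>k\<close> and \<open>A\<close> of the centred \<open>w\<^sub>k - u\<^sub>k\<close> stay in the space of first order sums,
  and orthogonality of the terms gives \<open>\<parallel>A\<parallel>\<^sub>1 + \<parallel>B\<parallel>\<^sub>2\<^sup>2 / r \<le> 3 D / r\<close>. It remains to see
  that, as long as \<open>V \<le> 2 r\<^sup>2\<close>, every decomposition \<open>F = g + h\<close> in the large couple costs at least a
  multiple of \<open>D / r\<close>.
  This is done by duality. Pairing \<open>F\<close> with \<open>\<Sum>\<^sub>k (u\<^sub>k - E u\<^sub>k) / (2 r)\<close> produces \<open>D / (2 r)\<close>, but this
  function is not bounded, as is required for pairing with \<open>g\<close>. Therefore the sum is stopped
  as soon as its partial sums leave the unit ball. The stopped sum \<open>\<phi>\<close> is bounded by 2 and has no larger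
  \<open>L\<^sup>2\<close> norm. By independence, the pairing of \<open>w\<^sub>k\<close> with \<open>\<phi>\<close> is that with the original \<open>k\<close>-th term
  times the probability that the stopping has not occurred before \<open>k\<close>, and this is at least 1/2
  by Kolmogorov's maximal inequality. If \<open>V > 2 r\<^sup>2\<close>, the same test with the
  function scaled down shows that \<open>r\<close> itself is bounded by a multiple of
  \<open>\<parallel>g\<parallel>\<^sub>1 + \<parallel>h\<parallel>\<^sub>2\<^sup>2 / r\<close>, hence so is \<open>\<parallel>F\<parallel>\<^sub>1\<close>, and \<open>A = F\<close>, \<open>B = 0\<close> will do.

  The vector-valued spaces enter through density: both subspaces are closures of one and the same space
  \<open>simple_sections\<close> of functions whose sections \<open>x \<mapsto> f(\<cdot>, x)\<close> are simple functions with values in the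
  finite first order sums. On it the scalar decomposition can be applied at every \<open>x\<close> without any
  question of measurable selection, since only finitely many sections occur.
\<close>

section \<open>Resampling one coordinate of an infinite product\<close>

lemma prob_space_infinite_power: "prob_space M \<Longrightarrow> prob_space (infinite_power M)"
  by (rule prob_space_PiM)

lemma integrable_inner_bounded:
  fixes f g :: "'a \<Rightarrow> 'k::euclidean_space"
  assumes f: "integrable M f" and [measurable]: "g \<in> borel_measurable M"
    and bdd: "\<And>x. norm (g x) \<le> C"
  shows "integrable M (\<lambda>x. inner (f x) (g x))"
proof (rule Bochner_Integration.integrable_bound)
  show "integrable M (\<lambda>x. C * norm (f x))" using f by auto
  have "\<bar>inner (f x) (g x)\<bar> \<le> C * norm (f x)" for x
    using order_trans[OF Cauchy_Schwarz_ineq2 mult_left_mono[OF bdd[of x]]] by (simp add: mult.commute)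
  then show "AE x in M. norm (inner (f x) (g x)) \<le> norm (C * norm (f x))"
    by (auto intro!: AE_I2 order_trans[OF _ abs_ge_self])
qed (use f in measurable)

context prob_space
begin

lemma integral_coordinate:
  fixes f :: "'a \<Rightarrow> 'b::{banach, second_countable_topology}"
  assumes [measurable]: "f \<in> borel_measurable M"
  shows "(\<integral>\<omega>. f (\<omega> k) \<partial>infinite_power M) = (\<integral>y. f y \<partial>M)"
proof -
  have "(\<integral>y. f y \<partial>M) = (\<integral>y. f y \<partial>distr (infinite_power M) M (\<lambda>\<omega>. \<omega> k))"
    by (subst distr_PiM_component) (auto simp: prob_space_axioms)
  also have "\<dots> = (\<integral>\<omega>. f (\<omega> k) \<partial>infinite_power M)"
    by (rule integral_distr) auto
  finally show ?thesis ..
qed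

lemma integrable_coordinate:
  fixes f :: "'a \<Rightarrow> 'b::{banach, second_countable_topology}"
  assumes f: "integrable M f"
  shows "integrable (infinite_power M) (\<lambda>\<omega>. f (\<omega> k))"
proof -
  have [measurable]: "f \<in> borel_measurable M" using f by auto
  have "integrable (distr (infinite_power M) M (\<lambda>\<omega>. \<omega> k)) f"
    using f by (subst distr_PiM_component) (auto simp: prob_space_axioms)
  then show ?thesis by (subst (asm) integrable_distr_eq) auto
qed

text \<open>
  The product measure does not change when coordinate \<open>k\<close> is replaced by an independent copy.
\<close>

lemma integral_resample_coordinate:
  fixes f :: "(nat \<Rightarrow> 'a) \<Rightarrow> 'b::{banach, second_countable_topology}"
  assumes f: "integrable (infinite_power M) f"
  shows "(\<integral>\<omega>. f \<omega> \<partial>infinite_power M) = (\<integral>\<omega>. (\<integral>y. f ((\<omega>)(k := y)) \<partial>M) \<partial>infinite_power M)"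
proof -
  let ?P = "infinite_power M"
  let ?T = "\<lambda>(y, \<omega>). (\<omega>)(k := y)"
  interpret P: prob_space ?P by (rule prob_space_infinite_power) (rule prob_space_axioms)
  interpret pair_sigma_finite M ?P ..
  have distr: "distr (M \<Otimes>\<^sub>M ?P) ?P ?T = ?P"
    using distr_pair_PiM_eq_PiM[of "UNIV :: nat set" "\<lambda>_. M" k] by (simp add: prob_space_axioms)
  have [measurable]: "?T \<in> measurable (M \<Otimes>\<^sub>M ?P) ?P"
    by (simp add: split_beta') (rule measurable_fun_upd[where J = UNIV]; simp)
  have [measurable]: "f \<in> borel_measurable ?P" using f by auto
  have "integrable (M \<Otimes>\<^sub>M ?P) (\<lambda>z. f (?T z))"
    using f by (subst integrable_distr_eq[symmetric, where N = ?P]) (auto simp: distr)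
  then have int: "integrable (M \<Otimes>\<^sub>M ?P) (case_prod (\<lambda>y \<omega>. f ((\<omega>)(k := y))))"
    by (simp add: split_beta')
  have "(\<integral>\<omega>. f \<omega> \<partial>?P) = (\<integral>\<omega>. f \<omega> \<partial>distr (M \<Otimes>\<^sub>M ?P) ?P ?T)"
    by (simp add: distr)
  also have "\<dots> = (\<integral>z. f (?T z) \<partial>(M \<Otimes>\<^sub>M ?P))"
    by (rule integral_distr) auto
  also have "\<dots> = (\<integral>\<omega>. (\<integral>y. f ((\<omega>)(k := y)) \<partial>M) \<partial>?P)"
    by (subst integral_snd[OF int]) (simp add: split_beta')
  finally show ?thesis .
qed

text \<open>
  Independence of one coordinate from the others, in the form in which it is used throughout: the
  invariance of \<open>G\<close> under updates at \<open>k\<close> expresses that \<open>G\<close> does not look at coordinate \<open>k\<close>, whether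
  it depends on earlier or on later coordinates. A bilinear map takes the place of the product, so that
  orthogonality (the inner product) and stopping weights (real factors) are covered at once.
\<close>

lemma integral_independent_coordinate:
  fixes G :: "(nat \<Rightarrow> 'a) \<Rightarrow> 'b::{banach, second_countable_topology}"
    and F :: "'a \<Rightarrow> 'c::{banach, second_countable_topology}"
    and b :: "'b \<Rightarrow> 'c \<Rightarrow> 'd::{banach, second_countable_topology}"
  assumes b: "bounded_bilinear b"
    and int: "integrable (infinite_power M) (\<lambda>\<omega>. b (G \<omega>) (F (\<omega> k)))"
    and G: "integrable (infinite_power M) G"
    and F: "integrable M F"
    and indep: "\<And>\<omega> y. G ((\<omega>)(k := y)) = G \<omega>"
  shows "(\<integral>\<omega>. b (G \<omega>) (F (\<omega> k)) \<partial>infinite_power M) = b (\<integral>\<omega>. G \<omega> \<partial>infinite_power M) (\<integral>y. F y \<partial>M)"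
proof -
  let ?P = "infinite_power M"
  interpret b: bounded_bilinear b by fact
  have "(\<integral>\<omega>. b (G \<omega>) (F (\<omega> k)) \<partial>?P) = (\<integral>\<omega>. (\<integral>y. b (G \<omega>) (F y) \<partial>M) \<partial>?P)"
    by (subst integral_resample_coordinate[OF int, of k]) (simp add: indep)
  also have "\<dots> = (\<integral>\<omega>. b (G \<omega>) (\<integral>y. F y \<partial>M) \<partial>?P)"
    by (intro Bochner_Integration.integral_cong refl
        integral_bounded_linear[OF b.bounded_linear_right] F)
  also have "\<dots> = b (\<integral>\<omega>. G \<omega> \<partial>?P) (\<integral>y. F y \<partial>M)"
    by (rule integral_bounded_linear[OF b.bounded_linear_left G])
  finally show ?thesis .
qed

end

section \<open>Stopped sums of independent variables\<close>

text \<open>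
  The stopping rule inspects only the partial sums of the terms before \<open>k\<close>, so that the
  decision whether the \<open>k\<close>-th term is still added is independent of \<open>\<omega>\<^sub>k\<close>.
\<close>

definition stays_small :: "(nat \<Rightarrow> 'a \<Rightarrow> 'k::real_normed_vector) \<Rightarrow> nat \<Rightarrow> (nat \<Rightarrow> 'a) \<Rightarrow> bool" where
  "stays_small v k \<omega> \<longleftrightarrow> (\<forall>j\<le>k. norm (\<Sum>i<j. v i (\<omega> i)) \<le> 1)"

definition stopped_term :: "(nat \<Rightarrow> 'a \<Rightarrow> 'k::real_normed_vector) \<Rightarrow> nat \<Rightarrow> (nat \<Rightarrow> 'a) \<Rightarrow> 'k" where
  "stopped_term v k \<omega> = of_bool (stays_small v k \<omega>) *\<^sub>R v k (\<omega> k)"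

definition stopped_sum :: "(nat \<Rightarrow> 'a \<Rightarrow> 'k::real_normed_vector) \<Rightarrow> nat \<Rightarrow> (nat \<Rightarrow> 'a) \<Rightarrow> 'k" where
  "stopped_sum v n \<omega> = (\<Sum>k<n. stopped_term v k \<omega>)"

lemma stays_small_update: "k \<le> m \<Longrightarrow> stays_small v k ((\<omega>)(m := y)) = stays_small v k \<omega>"
proof -
  assume "k \<le> m"
  then have "(\<Sum>i<j. v i (((\<omega>)(m := y)) i)) = (\<Sum>i<j. v i (\<omega> i))" if "j \<le> k" for j
    using that by (intro sum.cong) auto
  then show ?thesis by (simp add: stays_small_def)
qed

lemma stopped_term_update: "k < m \<Longrightarrow> stopped_term v k ((\<omega>)(m := y)) = stopped_term v k \<omega>"
  by (simp add: stopped_term_def stays_small_update)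

lemma stopped_sum_update: "n \<le> m \<Longrightarrow> stopped_sum v n ((\<omega>)(m := y)) = stopped_sum v n \<omega>"
  unfolding stopped_sum_def by (intro sum.cong refl stopped_term_update) simp

text \<open>
  The sum is frozen after the first step that leaves the unit ball, and that step has length at
  most 1. A frozen sum keeps norm greater than 1, which is what makes stopping an unlikely event below.
\<close>

lemma stopped_sum_bounds:
  fixes v :: "nat \<Rightarrow> 'a \<Rightarrow> 'k::real_normed_vector"
  assumes v: "\<And>k y. norm (v k y) \<le> 1"
  shows "norm (stopped_sum v n \<omega>) \<le> 2"
    and "\<not> stays_small v n \<omega> \<Longrightarrow> 1 < norm (stopped_sum v n \<omega>)"
proof -
  have "norm (stopped_sum v n \<omega>) \<le> 2 \<and>
      (if stays_small v n \<omega> then stopped_sum v n \<omega> = (\<Sum>i<n. v i (\<omega> i)) else 1 < norm (stopped_sum v n \<omega>))"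
  proof (induction n)
    case 0
    then show ?case by (simp add: stopped_sum_def stays_small_def)
  next
    case (Suc n)
    have Suc_small: "stays_small v (Suc n) \<omega> \<longleftrightarrow>
        stays_small v n \<omega> \<and> norm (\<Sum>i<Suc n. v i (\<omega> i)) \<le> 1"
      unfolding stays_small_def le_Suc_eq by blast
    show ?case
    proof (cases "stays_small v n \<omega>")
      case True
      then have eq: "stopped_sum v (Suc n) \<omega> = (\<Sum>i<Suc n. v i (\<omega> i))"
        using Suc by (simp add: stopped_sum_def stopped_term_def)
      have "norm (\<Sum>i<n. v i (\<omega> i)) \<le> 1" using True by (simp add: stays_small_def)
      then have "norm (\<Sum>i<Suc n. v i (\<omega> i)) \<le> 2"
        using v[of n "\<omega> n"] norm_triangle_ineq[of "\<Sum>i<n. v i (\<omega> i)" "v n (\<omega> n)"] by simp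
      then show ?thesis unfolding eq Suc_small using True by auto
    next
      case False
      then have "stopped_sum v (Suc n) \<omega> = stopped_sum v n \<omega>"
        by (simp add: stopped_sum_def stopped_term_def)
      then show ?thesis using Suc False by (simp add: Suc_small)
    qed
  qed
  then show "norm (stopped_sum v n \<omega>) \<le> 2"
    and "\<not> stays_small v n \<omega> \<Longrightarrow> 1 < norm (stopped_sum v n \<omega>)"
    by (auto split: if_splits)
qed

lemma measurable_stays_small [measurable]:
  fixes v :: "nat \<Rightarrow> 'a \<Rightarrow> 'k::{banach, second_countable_topology}"
  assumes [measurable]: "\<And>k. v k \<in> borel_measurable M"
  shows "Measurable.pred (infinite_power M) (stays_small v k)"
  unfolding stays_small_def by measurable

lemma measurable_stopped_sum [measurable]:
  fixes v :: "nat \<Rightarrow> 'a \<Rightarrow> 'k::{banach, second_countable_topology}"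
  assumes [measurable]: "\<And>k. v k \<in> borel_measurable M"
  shows "stopped_term v k \<in> borel_measurable (infinite_power M)"
    and "stopped_sum v n \<in> borel_measurable (infinite_power M)"
  unfolding stopped_sum_def[abs_def] stopped_term_def[abs_def] by measurable

lemma (in prob_space) integrable_stopped_sum_squared:
  fixes v :: "nat \<Rightarrow> 'a \<Rightarrow> 'k::euclidean_space"
  assumes [measurable]: "\<And>k. v k \<in> borel_measurable M"
    and bdd: "\<And>k y. norm (v k y) \<le> 1"
  shows "integrable (infinite_power M) (\<lambda>\<omega>. (norm (stopped_sum v n \<omega>))\<^sup>2)"
proof -
  interpret P: prob_space "infinite_power M"
    by (rule prob_space_infinite_power) (rule prob_space_axioms)
  have "(norm (stopped_sum v n \<omega>))\<^sup>2 \<le> 2\<^sup>2" for \<omega>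
    using stopped_sum_bounds(1)[of v, OF bdd] by (intro power_mono) auto
  then show ?thesis
    by (intro P.integrable_const_bound[where B = "2\<^sup>2"]) auto
qed

text \<open>
  The stopped terms are still orthogonal: given the past, the next one has mean zero.
\<close>

lemma (in prob_space) integral_stopped_sum_squared:
  fixes v :: "nat \<Rightarrow> 'a \<Rightarrow> 'k::euclidean_space"
  assumes [measurable]: "\<And>k. v k \<in> borel_measurable M"
    and bdd: "\<And>k y. norm (v k y) \<le> 1"
    and mean: "\<And>k. (\<integral>y. v k y \<partial>M) = 0"
  shows "(\<integral>\<omega>. (norm (stopped_sum v n \<omega>))\<^sup>2 \<partial>infinite_power M) \<le> (\<Sum>k<n. \<integral>y. (norm (v k y))\<^sup>2 \<partial>M)"
proof (induction n)
  case 0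
  then show ?case by (simp add: stopped_sum_def)
next
  case (Suc n)
  let ?P = "infinite_power M"
  interpret P: prob_space ?P by (rule prob_space_infinite_power) (rule prob_space_axioms)
  let ?G = "\<lambda>\<omega>. of_bool (stays_small v n \<omega>) *\<^sub>R stopped_sum v n \<omega>"
  have v_int: "integrable M (v n)"
    by (rule integrable_const_bound[where B = 1]) (auto simp: bdd)
  have v2_int: "integrable M (\<lambda>y. (norm (v n y))\<^sup>2)"
    by (rule integrable_const_bound[where B = 1]) (auto simp: bdd power_le_one)
  have G: "?G \<in> borel_measurable ?P" "norm (?G \<omega>) \<le> 2" "?G ((\<omega>)(n := y)) = ?G \<omega>" for \<omega> y
    using stopped_sum_bounds(1)[of v, OF bdd]
    by (measurable, auto simp: stays_small_update stopped_sum_update)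
  have G_int: "integrable ?P ?G"
    by (rule P.integrable_const_bound[where B = 2]) (use G in auto)
  have cross_int: "integrable ?P (\<lambda>\<omega>. inner (?G \<omega>) (v n (\<omega> n)))"
    by (rule integrable_inner_bounded[OF G_int, where C = 1]) (auto simp: bdd)
  note cross = cross_int
    integral_independent_coordinate[where b = inner and G = ?G and F = "v n" and k = n,
      OF bounded_bilinear_inner cross_int G_int v_int G(3)]
  have s_int: "integrable ?P (\<lambda>\<omega>. (norm (stopped_sum v n \<omega>))\<^sup>2)"
    by (rule integrable_stopped_sum_squared[OF assms(1) bdd])
  have "(norm (stopped_sum v (Suc n) \<omega>))\<^sup>2
      \<le> (norm (stopped_sum v n \<omega>))\<^sup>2 + 2 * inner (?G \<omega>) (v n (\<omega> n)) + (norm (v n (\<omega> n)))\<^sup>2" for \<omega>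
    by (simp add: stopped_sum_def stopped_term_def power2_norm_eq_inner inner_add inner_commute)
  then have "(\<integral>\<omega>. (norm (stopped_sum v (Suc n) \<omega>))\<^sup>2 \<partial>?P)
      \<le> (\<integral>\<omega>. (norm (stopped_sum v n \<omega>))\<^sup>2 + 2 * inner (?G \<omega>) (v n (\<omega> n)) + (norm (v n (\<omega> n)))\<^sup>2 \<partial>?P)"
    by (intro integral_mono integrable_stopped_sum_squared[OF assms(1) bdd]
        Bochner_Integration.integrable_add s_int
        integrable_mult_right cross(1) integrable_coordinate[OF v2_int])
  also have "\<dots> = (\<integral>\<omega>. (norm (stopped_sum v n \<omega>))\<^sup>2 \<partial>?P) + (\<integral>y. (norm (v n y))\<^sup>2 \<partial>M)"
    using s_int cross integrable_coordinate[OF v2_int] integral_coordinate[of "\<lambda>y. (norm (v n y))\<^sup>2" n]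
    by (simp add: mean)
  finally show ?case using Suc by simp
qed

text \<open>
  Kolmogorov's maximal inequality: where the stopping has occurred the stopped sum has norm greater than 1, so
  the probability of this is at most its second moment.
\<close>

lemma (in prob_space) prob_stays_small:
  fixes v :: "nat \<Rightarrow> 'a \<Rightarrow> 'k::euclidean_space"
  assumes [measurable]: "\<And>k. v k \<in> borel_measurable M"
    and bdd: "\<And>k y. norm (v k y) \<le> 1"
    and mean: "\<And>k. (\<integral>y. v k y \<partial>M) = 0"
    and small: "(\<Sum>k<n. \<integral>y. (norm (v k y))\<^sup>2 \<partial>M) \<le> 1/2" and "k \<le> n"
  shows "1/2 \<le> (\<integral>\<omega>. (of_bool (stays_small v k \<omega>) :: real) \<partial>infinite_power M)"
proof -
  let ?P = "infinite_power M"
  interpret P: prob_space ?P by (rule prob_space_infinite_power) (rule prob_space_axioms)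
  have s_int: "integrable ?P (\<lambda>\<omega>. (norm (stopped_sum v k \<omega>))\<^sup>2)"
    by (rule integrable_stopped_sum_squared[OF assms(1) bdd])
  have le: "1 - (norm (stopped_sum v k \<omega>))\<^sup>2 \<le> of_bool (stays_small v k \<omega>)" for \<omega>
    using stopped_sum_bounds(2)[where v = v and n = k and \<omega> = \<omega>, OF bdd]
    by (cases "stays_small v k \<omega>") (auto simp: less_imp_le intro: one_le_power)
  have b_int: "integrable ?P (\<lambda>\<omega>. of_bool (stays_small v k \<omega>) :: real)"
    by (intro P.integrable_const_bound[where B = 1]) auto
  have "(\<Sum>j<k. \<integral>y. (norm (v j y))\<^sup>2 \<partial>M) \<le> (\<Sum>j<n. \<integral>y. (norm (v j y))\<^sup>2 \<partial>M)"
    using \<open>k \<le> n\<close> by (intro sum_mono2) auto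
  then have "1/2 \<le> 1 - (\<integral>\<omega>. (norm (stopped_sum v k \<omega>))\<^sup>2 \<partial>?P)"
    using small integral_stopped_sum_squared[where v = v and n = k, OF assms(1) bdd mean] by simp
  also have "\<dots> = (\<integral>\<omega>. 1 - (norm (stopped_sum v k \<omega>))\<^sup>2 \<partial>?P)"
    using s_int by (simp add: P.prob_space)
  also have "\<dots> \<le> (\<integral>\<omega>. of_bool (stays_small v k \<omega>) \<partial>?P)"
    using s_int b_int le by (intro integral_mono) auto
  finally show ?thesis .
qed

text \<open>
  Only the \<open>k\<close>-th term of the stopped sum contributes. An earlier term is independent of \<open>\<omega>\<^sub>k\<close>, where
  \<open>f\<close> has mean zero. In a later term the factor \<open>v\<^sub>j(\<omega>\<^sub>j)\<close> has mean zero and is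
  independent of the rest of the product, including the stopping decision.
\<close>

lemma (in prob_space) integral_inner_stopped_sum:
  fixes v :: "nat \<Rightarrow> 'a \<Rightarrow> 'k::euclidean_space"
  assumes [measurable]: "\<And>k. v k \<in> borel_measurable M"
    and bdd: "\<And>k y. norm (v k y) \<le> 1"
    and mean: "\<And>k. (\<integral>y. v k y \<partial>M) = 0"
    and f: "integrable M f" "(\<integral>y. f y \<partial>M) = 0" and "k < n"
  shows "integrable (infinite_power M) (\<lambda>\<omega>. inner (f (\<omega> k)) (stopped_sum v n \<omega>))"
   and "(\<integral>\<omega>. inner (f (\<omega> k)) (stopped_sum v n \<omega>) \<partial>infinite_power M) =
    (\<integral>\<omega>. of_bool (stays_small v k \<omega>) \<partial>infinite_power M) * (\<integral>y. inner (f y) (v k y) \<partial>M)"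
proof -
  let ?P = "infinite_power M"
  interpret P: prob_space ?P by (rule prob_space_infinite_power) (rule prob_space_axioms)
  have [measurable]: "f \<in> borel_measurable M" using f by auto
  have fv: "integrable M (\<lambda>y. inner (f y) (v j y))" for j
    by (rule integrable_inner_bounded[OF f(1) _ bdd]) auto
  have v_int: "integrable M (v j)" for j
    by (rule integrable_const_bound[where B = 1]) (auto simp: bdd)
  have t_bdd: "norm (stopped_term v j \<omega>) \<le> 1" for j \<omega>
    using bdd[of j "\<omega> j"] by (simp add: stopped_term_def)
  have t_int: "integrable ?P (stopped_term v j)" for j
    by (rule P.integrable_const_bound[where B = 1]) (auto simp: t_bdd)
  have b_int: "integrable ?P (\<lambda>\<omega>. of_bool (stays_small v j \<omega>) :: real)" for j
    by (intro P.integrable_const_bound[where B = 1]) auto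
  have term_int: "integrable ?P (\<lambda>\<omega>. inner (f (\<omega> k)) (stopped_term v j \<omega>))" for j
    by (rule integrable_inner_bounded[OF integrable_coordinate[OF f(1)] _ t_bdd]) auto
  have terms: "(\<integral>\<omega>. inner (f (\<omega> k)) (stopped_term v j \<omega>) \<partial>?P) =
      (if j = k then (\<integral>\<omega>. of_bool (stays_small v k \<omega>) \<partial>?P) * (\<integral>y. inner (f y) (v k y) \<partial>M) else 0)" for j
  proof (cases j k rule: linorder_cases)
    case less
    then show ?thesis
      using integral_independent_coordinate[where b = inner and G = "stopped_term v j" and F = f and k = k,
          OF bounded_bilinear_inner _ t_int f(1)]
        term_int[of j] f(2) by (simp add: inner_commute stopped_term_update)
  next
    case equal
    have "integrable ?P (\<lambda>\<omega>. of_bool (stays_small v k \<omega>) * inner (f (\<omega> k)) (v k (\<omega> k)))"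
      using term_int[of k] by (simp add: stopped_term_def)
    then show ?thesis
      using integral_independent_coordinate[where b = "(*)" and k = k
            and G = "\<lambda>\<omega>. of_bool (stays_small v k \<omega>) :: real" and F = "\<lambda>y. inner (f y) (v k y)",
          OF bounded_bilinear_mult _ b_int fv]
        equal by (simp add: stopped_term_def stays_small_update)
  next
    case greater
    let ?G = "\<lambda>\<omega>. of_bool (stays_small v j \<omega>) *\<^sub>R f (\<omega> k)"
    have "integrable ?P ?G"
      by (rule Bochner_Integration.integrable_bound[OF integrable_coordinate[OF f(1)]]) auto
    moreover have "integrable ?P (\<lambda>\<omega>. inner (?G \<omega>) (v j (\<omega> j)))"
      using term_int[of j] by (simp add: stopped_term_def)
    ultimately show ?thesis
      using integral_independent_coordinate[where b = inner and G = ?G and F = "v j" and k = j,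
          OF bounded_bilinear_inner _ _ v_int]
        greater by (simp add: stopped_term_def stays_small_update mean)
  qed
  have eq: "inner (f (\<omega> k)) (stopped_sum v n \<omega>) = (\<Sum>j<n. inner (f (\<omega> k)) (stopped_term v j \<omega>))" for \<omega>
    by (simp add: stopped_sum_def inner_sum_right)
  show "integrable (infinite_power M) (\<lambda>\<omega>. inner (f (\<omega> k)) (stopped_sum v n \<omega>))"
    unfolding eq using term_int by auto
  show "(\<integral>\<omega>. inner (f (\<omega> k)) (stopped_sum v n \<omega>) \<partial>?P) =
    (\<integral>\<omega>. of_bool (stays_small v k \<omega>) \<partial>?P) * (\<integral>y. inner (f y) (v k y) \<partial>M)"
    unfolding eq using term_int \<open>k < n\<close> by (simp add: terms)
qed

section \<open>Pairing with stopped sums of truncations\<close>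

text \<open>
  The nearest point to \<open>z\<close> in the closed ball of radius \<open>r\<close> (for \<open>r \<ge> 0\<close>). At \<open>z = 0\<close> the
  convention \<open>r / 0 = 0\<close> is harmless.
\<close>

definition radial_truncation :: "real \<Rightarrow> 'k::euclidean_space \<Rightarrow> 'k" where
  "radial_truncation r z = min 1 (r / norm z) *\<^sub>R z"

lemma measurable_radial_truncation [measurable]:
  assumes [measurable]: "f \<in> borel_measurable M"
  shows "(\<lambda>y. radial_truncation r (f y)) \<in> borel_measurable M"
  unfolding radial_truncation_def by measurable

lemma radial_truncation:
  assumes "0 < r"
  shows norm_radial_truncation: "norm (radial_truncation r z) = min (norm z) r"
    and inner_radial_truncation: "inner z (radial_truncation r z) = norm z * min (norm z) r"
    and norm_diff_radial_truncation: "r * norm (z - radial_truncation r z) \<le> norm z * min (norm z) r"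
proof -
  have *: "min 1 (r / norm z) = (if norm z \<le> r \<and> z \<noteq> 0 then 1 else r / norm z)"
    using assms by (cases "z = 0") (auto simp: min_def le_divide_eq)
  show "norm (radial_truncation r z) = min (norm z) r"
    using assms unfolding radial_truncation_def * by (auto simp: min_def)
  show "inner z (radial_truncation r z) = norm z * min (norm z) r"
    using assms unfolding radial_truncation_def *
    by (auto simp: min_def field_simps power2_norm_eq_inner[symmetric] power2_eq_square)
  show "r * norm (z - radial_truncation r z) \<le> norm z * min (norm z) r"
  proof (cases "norm z \<le> r")
    case True
    then show ?thesis using assms unfolding radial_truncation_def * by (cases "z = 0") auto
  next
    case False
    have "z - (r / norm z) *\<^sub>R z = (1 - r / norm z) *\<^sub>R z"
      by (simp add: scaleR_left_diff_distrib)
    then have "norm (z - (r / norm z) *\<^sub>R z) = \<bar>1 - r / norm z\<bar> * norm z"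
      by simp
    also have "\<dots> = (1 - r / norm z) * norm z"
      using False assms by (subst abs_of_nonneg) (auto simp: divide_simps)
    also have "\<dots> = norm z - r"
      using False assms by (auto simp: left_diff_distrib)
    finally have "norm (z - (r / norm z) *\<^sub>R z) \<le> norm z" using assms by simp
    then show ?thesis using False assms unfolding radial_truncation_def *
      by (auto simp: mult.commute[of r] intro!: mult_right_mono)
  qed
qed

lemma (in finite_measure) integrable_of_square:
  fixes f :: "'a \<Rightarrow> 'k::{banach, second_countable_topology}"
  assumes [measurable]: "f \<in> borel_measurable M" and "integrable M (\<lambda>x. (norm (f x))\<^sup>2)"
  shows "integrable M f"
proof (rule Bochner_Integration.integrable_bound)
  show "integrable M (\<lambda>x. 1 + (norm (f x))\<^sup>2)" using assms by auto
  have "a \<le> 1 + a\<^sup>2" for a :: real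
    using zero_le_power2[of "a - 1"] zero_le_power2[of a]
    unfolding power2_diff one_power2 mult_1_right by linarith
  then show "AE x in M. norm (f x) \<le> norm (1 + (norm (f x))\<^sup>2)" by auto
qed auto

lemma integrable_inner_square:
  fixes f g :: "'a \<Rightarrow> 'k::euclidean_space"
  assumes [measurable]: "f \<in> borel_measurable M" "g \<in> borel_measurable M"
    and int: "integrable M (\<lambda>x. (norm (f x))\<^sup>2)" "integrable M (\<lambda>x. (norm (g x))\<^sup>2)"
  shows "integrable M (\<lambda>x. inner (f x) (g x))"
proof (rule Bochner_Integration.integrable_bound)
  show "integrable M (\<lambda>x. (norm (f x))\<^sup>2 + (norm (g x))\<^sup>2)" using int by auto
  have "\<bar>inner (f x) (g x)\<bar> \<le> (norm (f x))\<^sup>2 + (norm (g x))\<^sup>2" for x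
    using Cauchy_Schwarz_ineq2[of "f x" "g x"] sum_squares_bound[of "norm (f x)" "norm (g x)"]
      mult_nonneg_nonneg[of "norm (f x)" "norm (g x)"]
    by simp
  then show "AE x in M. norm (inner (f x) (g x)) \<le> norm ((norm (f x))\<^sup>2 + (norm (g x))\<^sup>2)" by auto
qed auto

lemma integrable_add_square:
  fixes f g :: "'a \<Rightarrow> 'k::euclidean_space"
  assumes [measurable]: "f \<in> borel_measurable M" "g \<in> borel_measurable M"
    and int: "integrable M (\<lambda>x. (norm (f x))\<^sup>2)" "integrable M (\<lambda>x. (norm (g x))\<^sup>2)"
  shows "integrable M (\<lambda>x. (norm (f x + g x))\<^sup>2)"
proof -
  have "(norm (f x + g x))\<^sup>2 = (norm (f x))\<^sup>2 + 2 * inner (f x) (g x) + (norm (g x))\<^sup>2" for x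
    by (simp add: power2_norm_eq_inner inner_add inner_commute)
  then show ?thesis using int integrable_inner_square[OF assms] by simp
qed

lemma (in prob_space) square_norm_centred:
  fixes f :: "'a \<Rightarrow> 'k::euclidean_space"
  assumes [measurable]: "f \<in> borel_measurable M" and int: "integrable M (\<lambda>x. (norm (f x))\<^sup>2)"
  shows "integrable M (\<lambda>x. (norm (f x - (\<integral>y. f y \<partial>M)))\<^sup>2)"
    and "(\<integral>x. (norm (f x - (\<integral>y. f y \<partial>M)))\<^sup>2 \<partial>M) \<le> (\<integral>x. (norm (f x))\<^sup>2 \<partial>M)"
proof -
  let ?c = "\<integral>y. f y \<partial>M"
  have f: "integrable M f" by (rule integrable_of_square[OF assms])
  have eq: "(norm (f x - ?c))\<^sup>2 = (norm (f x))\<^sup>2 - 2 * inner (f x) ?c + (norm ?c)\<^sup>2" for x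
    by (simp add: power2_norm_eq_inner inner_diff inner_commute)
  show "integrable M (\<lambda>x. (norm (f x - ?c))\<^sup>2)"
    unfolding eq using f int by auto
  have "(\<integral>x. (norm (f x - ?c))\<^sup>2 \<partial>M) = (\<integral>x. (norm (f x))\<^sup>2 \<partial>M) - 2 * inner ?c ?c + (norm ?c)\<^sup>2"
    unfolding eq using f int by (simp add: prob_space)
  then show "(\<integral>x. (norm (f x - ?c))\<^sup>2 \<partial>M) \<le> (\<integral>x. (norm (f x))\<^sup>2 \<partial>M)"
    by (simp add: power2_norm_eq_inner)
qed

lemma (in prob_space) square_norm_sum_coordinates:
  fixes w :: "nat \<Rightarrow> 'a \<Rightarrow> 'k::euclidean_space"
  assumes [measurable]: "\<And>k. w k \<in> borel_measurable M"
    and int: "\<And>k. integrable M (\<lambda>y. (norm (w k y))\<^sup>2)"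
    and mean: "\<And>k. (\<integral>y. w k y \<partial>M) = 0"
  shows "integrable (infinite_power M) (\<lambda>\<omega>. (norm (\<Sum>k<n. w k (\<omega> k)))\<^sup>2) \<and>
    (\<integral>\<omega>. (norm (\<Sum>k<n. w k (\<omega> k)))\<^sup>2 \<partial>infinite_power M) = (\<Sum>k<n. \<integral>y. (norm (w k y))\<^sup>2 \<partial>M)"
proof (induction n)
  case 0
  then show ?case by simp
next
  case (Suc n)
  let ?P = "infinite_power M"
  let ?S = "\<lambda>\<omega>. \<Sum>k<n. w k (\<omega> k)"
  interpret P: prob_space ?P by (rule prob_space_infinite_power) (rule prob_space_axioms)
  have S: "?S \<in> borel_measurable ?P" by measurable
  have w: "(\<lambda>\<omega>. w n (\<omega> n)) \<in> borel_measurable ?P" by measurable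
  have w2: "integrable ?P (\<lambda>\<omega>. (norm (w n (\<omega> n)))\<^sup>2)"
    by (rule integrable_coordinate[OF int])
  have S2: "integrable ?P (\<lambda>\<omega>. (norm (?S \<omega>))\<^sup>2)" using Suc by simp
  have cross: "integrable ?P (\<lambda>\<omega>. inner (?S \<omega>) (w n (\<omega> n)))"
    by (rule integrable_inner_square[OF S w S2 w2])
  have "(\<integral>\<omega>. inner (?S \<omega>) (w n (\<omega> n)) \<partial>?P) = inner (\<integral>\<omega>. ?S \<omega> \<partial>?P) (\<integral>y. w n y \<partial>M)"
    by (rule integral_independent_coordinate[OF bounded_bilinear_inner cross])
      (auto intro!: P.integrable_of_square[OF S S2] integrable_of_square int sum.cong)
  then have cross0: "(\<integral>\<omega>. inner (?S \<omega>) (w n (\<omega> n)) \<partial>?P) = 0" by (simp add: mean)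
  have eq: "(norm (\<Sum>k<Suc n. w k (\<omega> k)))\<^sup>2
      = (norm (?S \<omega>))\<^sup>2 + 2 * inner (?S \<omega>) (w n (\<omega> n)) + (norm (w n (\<omega> n)))\<^sup>2" for \<omega>
    by (simp add: power2_norm_eq_inner inner_add inner_commute)
  show ?case unfolding eq
    using S2 w2 cross cross0 Suc integral_coordinate[of "\<lambda>y. (norm (w n y))\<^sup>2" n] by simp
qed

text \<open>
  The finite sums of square integrable mean-zero functions of one coordinate each. They will turn
  out to be dense in both scalar spaces; for them every expression below is a finite sum, and sums of truncated terms
  are, after centring, again of this kind.
\<close>

definition first_order_sums :: "'a measure \<Rightarrow> ((nat \<Rightarrow> 'a) \<Rightarrow> 'k::euclidean_space) set" where
  "first_order_sums M = {(\<lambda>\<omega>. \<Sum>k<n. w k (\<omega> k)) | n w.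
    \<forall>k. w k \<in> borel_measurable M \<and> integrable M (\<lambda>y. (norm (w k y))\<^sup>2) \<and> (\<integral>y. w k y \<partial>M) = 0}"

text \<open>
  The lower bound for the cost of an arbitrary decomposition, obtained by pairing with the stopped
  sum of \<open>v\<^sub>k = \<theta> (u\<^sub>k - E u\<^sub>k) / (2 r)\<close>, where \<open>u\<^sub>k\<close> is the truncation of \<open>w\<^sub>k\<close>. The factor \<open>\<theta>\<close> allows the terms
  to be scaled down until the sum of their second moments is at most 1/2, which keeps the probability of stopping
  at most 1/2.
\<close>

lemma (in prob_space) pairing_inequality:
  fixes w :: "nat \<Rightarrow> 'a \<Rightarrow> 'k::euclidean_space"
  assumes [measurable]: "\<And>k. w k \<in> borel_measurable M"
    and w2: "\<And>k. integrable M (\<lambda>y. (norm (w k y))\<^sup>2)"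
    and mean: "\<And>k. (\<integral>y. w k y \<partial>M) = 0"
    and r: "0 < r" and \<theta>: "0 \<le> \<theta>" "\<theta> \<le> 1"
    and small: "\<theta>\<^sup>2 * (\<Sum>k<n. \<integral>y. (min (norm (w k y)) r)\<^sup>2 \<partial>M) \<le> 2 * r\<^sup>2"
    and g: "integrable (infinite_power M) g"
    and [measurable]: "h \<in> borel_measurable (infinite_power M)"
    and h: "integrable (infinite_power M) (\<lambda>\<omega>. (norm (h \<omega>))\<^sup>2)"
    and eq: "\<And>\<omega>. \<omega> \<in> space (infinite_power M) \<Longrightarrow> (\<Sum>k<n. w k (\<omega> k)) = g \<omega> + h \<omega>"
  shows "\<theta> * (\<Sum>k<n. \<integral>y. norm (w k y) * min (norm (w k y)) r \<partial>M) / (4 * r)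
    \<le> 2 * (\<integral>\<omega>. norm (g \<omega>) \<partial>infinite_power M) + (\<integral>\<omega>. (norm (h \<omega>))\<^sup>2 \<partial>infinite_power M) / r
      + \<theta>\<^sup>2 * (\<Sum>k<n. \<integral>y. (min (norm (w k y)) r)\<^sup>2 \<partial>M) / (16 * r)"
proof -
  let ?P = "infinite_power M"
  interpret P: prob_space ?P by (rule prob_space_infinite_power) (rule prob_space_axioms)
  define u where "u k y = radial_truncation r (w k y)" for k y
  define v where "v k y = (\<theta> / (2 * r)) *\<^sub>R (u k y - (\<integral>y. u k y \<partial>M))" for k y
  have [measurable]: "u k \<in> borel_measurable M" for k
    unfolding u_def[abs_def] by measurable
  have [measurable]: "v k \<in> borel_measurable M" for k
    unfolding v_def[abs_def] by measurable
  have [measurable]: "g \<in> borel_measurable ?P" using g by auto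
  have w_int: "integrable M (w k)" for k
    by (rule integrable_of_square[OF _ w2]) measurable
  have norm_u: "norm (u k y) = min (norm (w k y)) r" for k y
    by (simp add: u_def norm_radial_truncation[OF r])
  have u_bdd: "norm (u k y) \<le> r" for k y by (simp add: norm_u)
  have u_int: "integrable M (u k)" for k
    by (rule integrable_const_bound[where B = r]) (auto simp: u_bdd)
  have u2: "integrable M (\<lambda>y. (norm (u k y))\<^sup>2)" for k
    using u_bdd r by (intro integrable_const_bound[where B = "r\<^sup>2"]) (auto intro!: AE_I2 power_mono)
  have "norm (\<integral>y. u k y \<partial>M) \<le> (\<integral>y. norm (u k y) \<partial>M)" for k
    by (rule integral_norm_bound)
  also have "(\<integral>y. norm (u k y) \<partial>M) \<le> (\<integral>y. r \<partial>M)" for k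
    using u_int u_bdd by (intro integral_mono) auto
  finally have mean_u: "norm (\<integral>y. u k y \<partial>M) \<le> r" for k by (simp add: prob_space)
  have v_bdd: "norm (v k y) \<le> 1" for k y
  proof -
    have "norm (u k y - (\<integral>y. u k y \<partial>M)) \<le> 2 * r"
      using norm_triangle_ineq4[of "u k y" "\<integral>y. u k y \<partial>M"] u_bdd[of k y] mean_u[of k] by simp
    then have "(\<theta> / (2 * r)) * norm (u k y - (\<integral>y. u k y \<partial>M)) \<le> (\<theta> / (2 * r)) * (2 * r)"
      using r \<theta> by (intro mult_left_mono) auto
    also have "\<dots> \<le> 1" using r \<theta> by simp
    finally show ?thesis using r \<theta> by (simp add: v_def)
  qed
  have mean_v: "(\<integral>y. v k y \<partial>M) = 0" for k
    unfolding v_def using u_int by (simp add: prob_space)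
  have v2: "(\<integral>y. (norm (v k y))\<^sup>2 \<partial>M) \<le> (\<theta> / (2 * r))\<^sup>2 * (\<integral>y. (min (norm (w k y)) r)\<^sup>2 \<partial>M)" for k
  proof -
    have "(\<integral>y. (norm (v k y))\<^sup>2 \<partial>M) =
        (\<theta> / (2 * r))\<^sup>2 * (\<integral>y. (norm (u k y - (\<integral>y. u k y \<partial>M)))\<^sup>2 \<partial>M)"
      by (simp add: v_def power_mult_distrib power_divide)
    also have "\<dots> \<le> (\<theta> / (2 * r))\<^sup>2 * (\<integral>y. (norm (u k y))\<^sup>2 \<partial>M)"
      using u2 by (intro mult_left_mono square_norm_centred) auto
    finally show ?thesis by (simp add: norm_u)
  qed
  have sum_v2: "(\<Sum>k<n. \<integral>y. (norm (v k y))\<^sup>2 \<partial>M)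
      \<le> \<theta>\<^sup>2 * (\<Sum>k<n. \<integral>y. (min (norm (w k y)) r)\<^sup>2 \<partial>M) / (4 * r\<^sup>2)"
    using sum_mono[where K = "{..<n}", OF v2]
    by (simp add: sum_distrib_left power_divide power_mult_distrib sum_divide_distrib)
  also have "\<dots> \<le> 1 / 2" using small r by (simp add: field_simps)
  finally have sum_v2_half: "(\<Sum>k<n. \<integral>y. (norm (v k y))\<^sup>2 \<partial>M) \<le> 1 / 2" .
  have inner_wv: "(\<integral>y. inner (w k y) (v k y) \<partial>M) =
      \<theta> / (2 * r) * (\<integral>y. norm (w k y) * min (norm (w k y)) r \<partial>M)" for k
  proof -
    have "integrable M (\<lambda>y. inner (w k y) (u k y))"
      by (rule integrable_inner_bounded[OF w_int _ u_bdd]) measurable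
    then have "(\<integral>y. inner (w k y) (v k y) \<partial>M) =
        \<theta> / (2 * r) * ((\<integral>y. inner (w k y) (u k y) \<partial>M) - inner (\<integral>y. w k y \<partial>M) (\<integral>y. u k y \<partial>M))"
      using w_int by (simp add: v_def inner_diff_right)
    then show ?thesis
      by (simp add: mean u_def inner_radial_truncation[OF r])
  qed
  define \<phi> where "\<phi> = stopped_sum v n"
  have [measurable]: "\<phi> \<in> borel_measurable ?P" unfolding \<phi>_def by measurable
  have \<phi>_bdd: "norm (\<phi> \<omega>) \<le> 2" for \<omega>
    unfolding \<phi>_def by (rule stopped_sum_bounds(1)[of v, OF v_bdd])
  have \<phi>2: "integrable ?P (\<lambda>\<omega>. (norm (\<phi> \<omega>))\<^sup>2)"
    unfolding \<phi>_def by (rule integrable_stopped_sum_squared[of v, OF _ v_bdd]) measurable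
  have \<phi>2_le: "(\<integral>\<omega>. (norm (\<phi> \<omega>))\<^sup>2 \<partial>?P) \<le> (\<Sum>k<n. \<integral>y. (norm (v k y))\<^sup>2 \<partial>M)"
    unfolding \<phi>_def by (rule integral_stopped_sum_squared[of v, OF _ v_bdd mean_v]) measurable
  note pairing = integral_inner_stopped_sum[where v = v and n = n, OF _ v_bdd mean_v w_int mean]
  \<comment> \<open>Stopping costs at most half of each pairing, since all these pairings are nonnegative.\<close>
  have lower: "\<theta> / (4 * r) * (\<integral>y. norm (w k y) * min (norm (w k y)) r \<partial>M)
      \<le> (\<integral>\<omega>. inner (w k (\<omega> k)) (\<phi> \<omega>) \<partial>?P)" if "k < n" for k
  proof -
    have "0 \<le> (\<integral>y. norm (w k y) * min (norm (w k y)) r \<partial>M)"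
      using r by (intro Bochner_Integration.integral_nonneg) auto
    then have "1/2 * (\<integral>y. inner (w k y) (v k y) \<partial>M)
        \<le> (\<integral>\<omega>. of_bool (stays_small v k \<omega>) \<partial>?P) * (\<integral>y. inner (w k y) (v k y) \<partial>M)"
      using that r \<theta> unfolding inner_wv
      by (intro mult_right_mono prob_stays_small[of v, OF _ v_bdd mean_v sum_v2_half]) auto
    also have "\<dots> = (\<integral>\<omega>. inner (w k (\<omega> k)) (\<phi> \<omega>) \<partial>?P)"
      unfolding \<phi>_def by (rule pairing(2)[symmetric]) (use that in auto)
    finally show ?thesis unfolding inner_wv by simp
  qed
  have "\<theta> * (\<Sum>k<n. \<integral>y. norm (w k y) * min (norm (w k y)) r \<partial>M) / (4 * r)
      = (\<Sum>k<n. \<theta> / (4 * r) * (\<integral>y. norm (w k y) * min (norm (w k y)) r \<partial>M))"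
    by (simp add: sum_distrib_left sum_divide_distrib)
  also have "\<dots> \<le> (\<Sum>k<n. \<integral>\<omega>. inner (w k (\<omega> k)) (\<phi> \<omega>) \<partial>?P)"
    by (intro sum_mono lower) simp
  also have "\<dots> = (\<integral>\<omega>. inner (\<Sum>k<n. w k (\<omega> k)) (\<phi> \<omega>) \<partial>?P)"
    unfolding inner_sum_left
    by (rule Bochner_Integration.integral_sum[symmetric]) (auto simp: \<phi>_def intro!: pairing(1))
  also have "\<dots> = (\<integral>\<omega>. inner (g \<omega>) (\<phi> \<omega>) + inner (h \<omega>) (\<phi> \<omega>) \<partial>?P)"
    by (rule Bochner_Integration.integral_cong) (auto simp: eq inner_add_left)
  also have "\<dots> \<le> (\<integral>\<omega>. 2 * norm (g \<omega>) + ((norm (h \<omega>))\<^sup>2 / r + r / 4 * (norm (\<phi> \<omega>))\<^sup>2) \<partial>?P)"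
  proof (rule integral_mono)
    show "integrable ?P (\<lambda>\<omega>. inner (g \<omega>) (\<phi> \<omega>) + inner (h \<omega>) (\<phi> \<omega>))"
      by (intro Bochner_Integration.integrable_add integrable_inner_bounded[OF g _ \<phi>_bdd]
          integrable_inner_square h \<phi>2) auto
    show "integrable ?P (\<lambda>\<omega>. 2 * norm (g \<omega>) + ((norm (h \<omega>))\<^sup>2 / r + r / 4 * (norm (\<phi> \<omega>))\<^sup>2))"
      using g h \<phi>2 by auto
    fix \<omega>
    have "inner (g \<omega>) (\<phi> \<omega>) \<le> norm (g \<omega>) * norm (\<phi> \<omega>)" by (rule norm_cauchy_schwarz)
    also have "\<dots> \<le> norm (g \<omega>) * 2" using \<phi>_bdd by (intro mult_left_mono) auto
    finally have 1: "inner (g \<omega>) (\<phi> \<omega>) \<le> 2 * norm (g \<omega>)" by simp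
    have "inner (h \<omega>) (\<phi> \<omega>) \<le> norm (h \<omega>) * norm (\<phi> \<omega>)" by (rule norm_cauchy_schwarz)
    \<comment> \<open>The weights in Young's inequality are chosen so that the term in \<open>\<phi>\<close> can later be absorbed.\<close>
    also have "\<dots> \<le> (norm (h \<omega>))\<^sup>2 / r + r / 4 * (norm (\<phi> \<omega>))\<^sup>2"
    proof -
      have "0 \<le> (norm (h \<omega>) - r / 2 * norm (\<phi> \<omega>))\<^sup>2 / r" using r by simp
      also have "\<dots> = (norm (h \<omega>))\<^sup>2 / r + r / 4 * (norm (\<phi> \<omega>))\<^sup>2 - norm (h \<omega>) * norm (\<phi> \<omega>)"
        using r by (simp add: field_simps power2_eq_square)
      finally show ?thesis by simp
    qed
    finally show "inner (g \<omega>) (\<phi> \<omega>) + inner (h \<omega>) (\<phi> \<omega>)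
      \<le> 2 * norm (g \<omega>) + ((norm (h \<omega>))\<^sup>2 / r + r / 4 * (norm (\<phi> \<omega>))\<^sup>2)"
      using 1 by simp
  qed
  also have "\<dots> = 2 * (\<integral>\<omega>. norm (g \<omega>) \<partial>?P) + (\<integral>\<omega>. (norm (h \<omega>))\<^sup>2 \<partial>?P) / r
      + r / 4 * (\<integral>\<omega>. (norm (\<phi> \<omega>))\<^sup>2 \<partial>?P)"
    using g h \<phi>2 by simp
  also have "r / 4 * (\<integral>\<omega>. (norm (\<phi> \<omega>))\<^sup>2 \<partial>?P)
      \<le> r / 4 * (\<theta>\<^sup>2 * (\<Sum>k<n. \<integral>y. (min (norm (w k y)) r)\<^sup>2 \<partial>M) / (4 * r\<^sup>2))"
    using r \<phi>2_le sum_v2 by (intro mult_left_mono) auto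
  also have "\<dots> = \<theta>\<^sup>2 * (\<Sum>k<n. \<integral>y. (min (norm (w k y)) r)\<^sup>2 \<partial>M) / (16 * r)"
    using r by (simp add: field_simps power2_eq_square)
  finally show ?thesis by simp
qed

section \<open>Decomposing a first order sum\<close>

lemma first_order_sumsE:
  assumes "F \<in> first_order_sums M"
  obtains n w where "F = (\<lambda>\<omega>. \<Sum>k<n. w k (\<omega> k))"
    and "\<And>k. w k \<in> borel_measurable M" "\<And>k. integrable M (\<lambda>y. (norm (w k y))\<^sup>2)"
    and "\<And>k. (\<integral>y. w k y \<partial>M) = 0"
  using assms unfolding first_order_sums_def by blast

lemma first_order_sumsI:
  fixes w :: "nat \<Rightarrow> 'a \<Rightarrow> 'k::euclidean_space"
  assumes "\<And>k. w k \<in> borel_measurable M" "\<And>k. integrable M (\<lambda>y. (norm (w k y))\<^sup>2)"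
    and "\<And>k. (\<integral>y. w k y \<partial>M) = 0"
  shows "(\<lambda>\<omega>. \<Sum>k<n. w k (\<omega> k)) \<in> first_order_sums M"
  using assms unfolding first_order_sums_def by blast

lemma (in prob_space) first_order_sums_square_integrable:
  fixes F :: "(nat \<Rightarrow> 'a) \<Rightarrow> 'k::euclidean_space"
  assumes "F \<in> first_order_sums M"
  shows "F \<in> borel_measurable (infinite_power M)"
    and "integrable (infinite_power M) (\<lambda>\<omega>. (norm (F \<omega>))\<^sup>2)"
    and "integrable (infinite_power M) F"
proof -
  interpret P: prob_space "infinite_power M" by (rule prob_space_infinite_power) (rule prob_space_axioms)
  obtain n w where F: "F = (\<lambda>\<omega>. \<Sum>k<n. w k (\<omega> k))"
    and w[measurable]: "\<And>k. w k \<in> borel_measurable M"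
    and "\<And>k. integrable M (\<lambda>y. (norm (w k y))\<^sup>2)" "\<And>k. (\<integral>y. w k y \<partial>M) = 0"
    by (rule first_order_sumsE[OF assms]) blast
  then show 2: "integrable (infinite_power M) (\<lambda>\<omega>. (norm (F \<omega>))\<^sup>2)"
    unfolding F using square_norm_sum_coordinates[of w n] by auto
  show 1: "F \<in> borel_measurable (infinite_power M)" unfolding F by measurable
  show "integrable (infinite_power M) F" by (rule P.integrable_of_square[OF 1 2])
qed

text \<open>
  Centring a variable at most doubles its \<open>L\<^sup>1\<close> norm and does not increase its \<open>L\<^sup>2\<close> norm; the centred
  terms are orthogonal, so their squared norms add up.
\<close>

lemma (in prob_space) first_order_centred:
  fixes w :: "nat \<Rightarrow> 'a \<Rightarrow> 'k::euclidean_space" and n :: nat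
  assumes [measurable]: "\<And>k. w k \<in> borel_measurable M"
    and int: "\<And>k. integrable M (\<lambda>y. (norm (w k y))\<^sup>2)"
  defines "F \<equiv> \<lambda>\<omega>. \<Sum>k<n. w k (\<omega> k) - (\<integral>y. w k y \<partial>M)"
  shows "F \<in> first_order_sums M"
    and "(\<integral>\<omega>. norm (F \<omega>) \<partial>infinite_power M) \<le> 2 * (\<Sum>k<n. \<integral>y. norm (w k y) \<partial>M)"
    and "(\<integral>\<omega>. (norm (F \<omega>))\<^sup>2 \<partial>infinite_power M) \<le> (\<Sum>k<n. \<integral>y. (norm (w k y))\<^sup>2 \<partial>M)"
proof -
  let ?P = "infinite_power M"
  let ?c = "\<lambda>k y. w k y - (\<integral>y. w k y \<partial>M)"
  interpret P: prob_space ?P by (rule prob_space_infinite_power) (rule prob_space_axioms)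
  have w: "integrable M (w k)" for k by (rule integrable_of_square[OF _ int]) measurable
  have c: "?c k \<in> borel_measurable M" "integrable M (\<lambda>y. (norm (?c k y))\<^sup>2)" "(\<integral>y. ?c k y \<partial>M) = 0" for k
    using w[of k] square_norm_centred(1)[OF _ int[of k]] by (auto simp: prob_space)
  show F: "F \<in> first_order_sums M"
    unfolding F_def using c by (rule first_order_sumsI[where w = ?c])
  have "(\<integral>\<omega>. (norm (F \<omega>))\<^sup>2 \<partial>?P) = (\<Sum>k<n. \<integral>y. (norm (?c k y))\<^sup>2 \<partial>M)"
    unfolding F_def using square_norm_sum_coordinates[where w = ?c and n = n, OF c] by simp
  also have "\<dots> \<le> (\<Sum>k<n. \<integral>y. (norm (w k y))\<^sup>2 \<partial>M)"
    by (intro sum_mono square_norm_centred int) measurable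
  finally show "(\<integral>\<omega>. (norm (F \<omega>))\<^sup>2 \<partial>?P) \<le> (\<Sum>k<n. \<integral>y. (norm (w k y))\<^sup>2 \<partial>M)" .
  have "(\<integral>\<omega>. norm (F \<omega>) \<partial>?P) \<le> (\<integral>\<omega>. (\<Sum>k<n. norm (w k (\<omega> k)) + (\<integral>y. norm (w k y) \<partial>M)) \<partial>?P)"
  proof (rule integral_mono)
    show "integrable ?P (\<lambda>\<omega>. norm (F \<omega>))"
      using first_order_sums_square_integrable(3)[OF F] by auto
    show "integrable ?P (\<lambda>\<omega>. \<Sum>k<n. norm (w k (\<omega> k)) + (\<integral>y. norm (w k y) \<partial>M))"
      using w by (auto intro!: Bochner_Integration.integrable_sum integrable_coordinate)
    have "norm (?c k y) \<le> norm (w k y) + (\<integral>y. norm (w k y) \<partial>M)" for k y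
      using norm_triangle_ineq4[of "w k y" "\<integral>y. w k y \<partial>M"] integral_norm_bound[of M "w k"] by linarith
    then show "norm (F \<omega>) \<le> (\<Sum>k<n. norm (w k (\<omega> k)) + (\<integral>y. norm (w k y) \<partial>M))" for \<omega>
      unfolding F_def by (intro sum_norm_le)
  qed
  also have "\<dots> = (\<Sum>k<n. (\<integral>\<omega>. norm (w k (\<omega> k)) \<partial>?P) + (\<integral>y. norm (w k y) \<partial>M))"
    using w integrable_coordinate[OF integrable_norm[OF w]] by (simp add: P.prob_space)
  also have "\<dots> = 2 * (\<Sum>k<n. \<integral>y. norm (w k y) \<partial>M)"
    using integral_coordinate[of "\<lambda>y. norm (w k y)" k for k] by (simp add: sum_distrib_left)
  finally show "(\<integral>\<omega>. norm (F \<omega>) \<partial>?P) \<le> 2 * (\<Sum>k<n. \<integral>y. norm (w k y) \<partial>M)" .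
qed

text \<open>
  The scalar form of the theorem. The decomposition is chosen before \<open>g\<close> and \<open>h\<close>, so it is
  simultaneously good for all competitors; this is what allows it to be used at every point \<open>x\<close> separately.
\<close>

lemma (in prob_space) first_order_decomposition:
  fixes F :: "(nat \<Rightarrow> 'a) \<Rightarrow> 'k::euclidean_space"
  assumes F: "F \<in> first_order_sums M" and r: "0 < r"
  shows "\<exists>A\<in>first_order_sums M. \<exists>B\<in>first_order_sums M. (\<forall>\<omega>. F \<omega> = A \<omega> + B \<omega>) \<and>
    (\<forall>g h. integrable (infinite_power M) g \<longrightarrow> h \<in> borel_measurable (infinite_power M) \<longrightarrow>
      integrable (infinite_power M) (\<lambda>\<omega>. (norm (h \<omega>))\<^sup>2) \<longrightarrow>
      (\<forall>\<omega>\<in>space (infinite_power M). F \<omega> = g \<omega> + h \<omega>) \<longrightarrow>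
      (\<integral>\<omega>. norm (A \<omega>) \<partial>infinite_power M) + (\<integral>\<omega>. (norm (B \<omega>))\<^sup>2 \<partial>infinite_power M) / r
      \<le> 32 * ((\<integral>\<omega>. norm (g \<omega>) \<partial>infinite_power M) + (\<integral>\<omega>. (norm (h \<omega>))\<^sup>2 \<partial>infinite_power M) / r))"
    (is "\<exists>A\<in>_. \<exists>B\<in>_. _ \<and> ?bound A B")
proof -
  let ?P = "infinite_power M"
  interpret P: prob_space ?P by (rule prob_space_infinite_power) (rule prob_space_axioms)
  obtain n w where F_eq: "F = (\<lambda>\<omega>. \<Sum>k<n. w k (\<omega> k))"
    and w[measurable]: "\<And>k. w k \<in> borel_measurable M"
    and w2: "\<And>k. integrable M (\<lambda>y. (norm (w k y))\<^sup>2)" and mean: "\<And>k. (\<integral>y. w k y \<partial>M) = 0"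
    by (rule first_order_sumsE[OF F]) blast
  have w_int: "integrable M (w k)" for k by (rule integrable_of_square[OF w w2])
  define V where "V = (\<Sum>k<n. \<integral>y. (min (norm (w k y)) r)\<^sup>2 \<partial>M)"
  define D where "D = (\<Sum>k<n. \<integral>y. norm (w k y) * min (norm (w k y)) r \<partial>M)"
  have D_int: "integrable M (\<lambda>y. norm (w k y) * min (norm (w k y)) r)" for k
    by (rule Bochner_Integration.integrable_bound[OF w2[of k]])
      (use r in \<open>auto simp: power2_eq_square intro!: AE_I2 mult_left_mono\<close>)
  have V_int: "integrable M (\<lambda>y. (min (norm (w k y)) r)\<^sup>2)" for k
    by (rule Bochner_Integration.integrable_bound[OF w2[of k]])
      (use r in \<open>auto intro!: AE_I2 power_mono\<close>)
  \<comment> \<open>\<open>V\<close> controls the square norm of the truncated part, \<open>D\<close> the \<open>L\<^sup>1\<close> norm of the remainder.\<close>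
  have "V \<le> D"
    unfolding V_def D_def using r
    by (intro sum_mono integral_mono V_int D_int) (auto simp: power2_eq_square intro!: mult_right_mono)
  have V0: "0 \<le> V" unfolding V_def by (intro sum_nonneg Bochner_Integration.integral_nonneg) auto
  note test = pairing_inequality[where w = w and n = n and r = r, OF w w2 mean r, folded V_def D_def]
  show ?thesis
  proof (cases "V \<le> 2 * r\<^sup>2")
    case True
    define u where "u k y = radial_truncation r (w k y)" for k y
    have [measurable]: "u k \<in> borel_measurable M" for k unfolding u_def[abs_def] by measurable
    have norm_u: "norm (u k y) = min (norm (w k y)) r" for k y
      by (simp add: u_def norm_radial_truncation[OF r])
    have u2: "integrable M (\<lambda>y. (norm (u k y))\<^sup>2)" for k unfolding norm_u by (rule V_int)
    have u_int: "integrable M (u k)" for k by (rule integrable_of_square[OF _ u2]) measurable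
    define A where "A \<omega> = (\<Sum>k<n. (w k (\<omega> k) - u k (\<omega> k)) - (\<integral>y. w k y - u k y \<partial>M))" for \<omega>
    define B where "B \<omega> = (\<Sum>k<n. u k (\<omega> k) - (\<integral>y. u k y \<partial>M))" for \<omega>
    have "integrable M (\<lambda>y. (norm (w k y - u k y))\<^sup>2)" for k
      using integrable_add_square[of "w k" M "\<lambda>y. - u k y"] w2 u2 by simp
    note A = first_order_centred[where w = "\<lambda>k y. w k y - u k y" and n = n, OF _ this, folded A_def]
    note B = first_order_centred[where w = u and n = n, OF _ u2, folded B_def]
    have A_le: "(\<integral>\<omega>. norm (A \<omega>) \<partial>?P) \<le> 2 * D / r"
    proof -
      have "(\<integral>\<omega>. norm (A \<omega>) \<partial>?P) \<le> 2 * (\<Sum>k<n. \<integral>y. norm (w k y - u k y) \<partial>M)"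
        by (rule A(2)) measurable
      also have "(\<Sum>k<n. \<integral>y. norm (w k y - u k y) \<partial>M)
          \<le> (\<Sum>k<n. \<integral>y. norm (w k y) * min (norm (w k y)) r / r \<partial>M)"
      proof (intro sum_mono integral_mono)
        show "norm (w k y - u k y) \<le> norm (w k y) * min (norm (w k y)) r / r" for k y
          using norm_diff_radial_truncation[OF r, of "w k y"] r by (simp add: u_def field_simps)
      qed (use w_int u_int D_int in auto)
      finally show ?thesis using r by (simp add: D_def sum_divide_distrib[symmetric])
    qed
    have B_le: "(\<integral>\<omega>. (norm (B \<omega>))\<^sup>2 \<partial>?P) \<le> D"
      using B(3) \<open>V \<le> D\<close> by (simp add: norm_u V_def)
    have "?bound A B"
    proof (intro allI impI)
      fix g h
      assume "integrable ?P g" "h \<in> borel_measurable ?P" "integrable ?P (\<lambda>\<omega>. (norm (h \<omega>))\<^sup>2)"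
        "\<forall>\<omega>\<in>space ?P. F \<omega> = g \<omega> + h \<omega>"
      then have "1 * D / (4 * r) \<le> 2 * (\<integral>\<omega>. norm (g \<omega>) \<partial>?P) + (\<integral>\<omega>. (norm (h \<omega>))\<^sup>2 \<partial>?P) / r + 1\<^sup>2 * V / (16 * r)"
        using True by (intro test) (auto simp: F_eq)
      also have "1\<^sup>2 * V / (16 * r) \<le> D / (16 * r)"
        using \<open>V \<le> D\<close> r by (simp add: divide_right_mono)
      finally have "3 * (D / r) \<le> 32 * (\<integral>\<omega>. norm (g \<omega>) \<partial>?P) + 16 * ((\<integral>\<omega>. (norm (h \<omega>))\<^sup>2 \<partial>?P) / r)"
        by simp
      moreover have "(\<integral>\<omega>. (norm (B \<omega>))\<^sup>2 \<partial>?P) / r \<le> D / r"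
        using B_le r by (simp add: divide_right_mono)
      moreover have "0 \<le> (\<integral>\<omega>. (norm (h \<omega>))\<^sup>2 \<partial>?P) / r"
        using r by (intro divide_nonneg_pos Bochner_Integration.integral_nonneg) auto
      ultimately show "(\<integral>\<omega>. norm (A \<omega>) \<partial>?P) + (\<integral>\<omega>. (norm (B \<omega>))\<^sup>2 \<partial>?P) / r
          \<le> 32 * ((\<integral>\<omega>. norm (g \<omega>) \<partial>?P) + (\<integral>\<omega>. (norm (h \<omega>))\<^sup>2 \<partial>?P) / r)"
        using A_le by simp
    qed
    moreover have "A \<in> first_order_sums M" "B \<in> first_order_sums M"
      by (rule A(1), measurable) (rule B(1), measurable)
    moreover have "F \<omega> = A \<omega> + B \<omega>" for \<omega>
      using w_int u_int by (simp add: F_eq A_def B_def mean sum.distrib[symmetric])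
    ultimately show ?thesis by blast
  next
    case False
    \<comment> \<open>The truncated part is too large for the unscaled test. The largest admissible scaling shows that
      \<open>r\<close> is dominated by the cost of any decomposition, so the \<open>L\<^sup>2\<close> part can be omitted altogether.\<close>
    define \<theta> where "\<theta> = sqrt (2 * r\<^sup>2 / V)"
    have V: "0 < V" using False r by (meson not_le order_le_less_trans zero_le_power2 mult_nonneg_nonneg zero_le_numeral)
    have \<theta>: "0 \<le> \<theta>" "\<theta> \<le> 1" "\<theta>\<^sup>2 * V = 2 * r\<^sup>2"
      using False V by (auto simp: \<theta>_def)
    have "(2 * r\<^sup>2)\<^sup>2 \<le> (2 * r\<^sup>2) * V" using False r by (simp add: power2_eq_square)
    also have "\<dots> = (\<theta> * V)\<^sup>2" using \<theta>(3) by (simp add: power2_eq_square algebra_simps)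
finally have "2 * r\<^sup>2 \<le> \<theta> * V" by (rule power2_le_imp_le) (use \<theta>(1) V in simp)
    also have "\<dots> \<le> \<theta> * D" using \<theta>(1) \<open>V \<le> D\<close> by (intro mult_left_mono)
    finally have D: "2 * r\<^sup>2 \<le> \<theta> * D" .
    have "?bound F (\<lambda>\<omega>. 0)"
    proof (intro allI impI)
      fix g h
      assume g: "integrable ?P g" and h[measurable]: "h \<in> borel_measurable ?P"
        and h2: "integrable ?P (\<lambda>\<omega>. (norm (h \<omega>))\<^sup>2)"
        and eq: "\<forall>\<omega>\<in>space ?P. F \<omega> = g \<omega> + h \<omega>"
      let ?G = "\<integral>\<omega>. norm (g \<omega>) \<partial>?P" and ?H = "(\<integral>\<omega>. (norm (h \<omega>))\<^sup>2 \<partial>?P) / r"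
      have "r / 2 = 2 * r\<^sup>2 / (4 * r)" using r by (simp add: power2_eq_square)
      also have "\<dots> \<le> \<theta> * D / (4 * r)" using D r by (intro divide_right_mono) auto
      also have "\<dots> \<le> 2 * ?G + ?H + \<theta>\<^sup>2 * V / (16 * r)"
        using \<theta> eq by (intro test g h h2) (auto simp: F_eq)
      also have "\<theta>\<^sup>2 * V / (16 * r) = r / 8" unfolding \<theta>(3) using r by (simp add: power2_eq_square)
      finally have r_le: "3 * r \<le> 16 * ?G + 8 * ?H" by simp
      have "(\<integral>\<omega>. norm (F \<omega>) \<partial>?P) \<le> (\<integral>\<omega>. norm (g \<omega>) + ((norm (h \<omega>))\<^sup>2 / r + r / 4) \<partial>?P)"
      proof (rule integral_mono)
        show "integrable ?P (\<lambda>\<omega>. norm (F \<omega>))"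
          using first_order_sums_square_integrable(3)[OF F] by auto
        show "integrable ?P (\<lambda>\<omega>. norm (g \<omega>) + ((norm (h \<omega>))\<^sup>2 / r + r / 4))"
          using g h2 by auto
        fix \<omega> assume \<omega>: "\<omega> \<in> space ?P"
        have "0 \<le> (norm (h \<omega>) - r / 2)\<^sup>2 / r" using r by simp
        also have "\<dots> = (norm (h \<omega>))\<^sup>2 / r + r / 4 - norm (h \<omega>)"
          using r by (simp add: field_simps power2_eq_square)
        finally show "norm (F \<omega>) \<le> norm (g \<omega>) + ((norm (h \<omega>))\<^sup>2 / r + r / 4)"
          using eq \<omega> norm_triangle_ineq[of "g \<omega>" "h \<omega>"] by simp
      qed
      also have "\<dots> = ?G + (?H + r / 4)" using g h2 by (simp add: P.prob_space)
      finally have "(\<integral>\<omega>. norm (F \<omega>) \<partial>?P) \<le> ?G + (?H + r / 4)" .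
      moreover have "0 \<le> ?G" "0 \<le> ?H"
        using r by (auto intro!: divide_nonneg_pos Bochner_Integration.integral_nonneg)
      moreover have "x \<le> 32 * (a + b)" if "x \<le> a + (b + r / 4)" "0 \<le> a" "0 \<le> b" "3 * r \<le> 16 * a + 8 * b"
        for x a b :: real using that by simp
      ultimately have "(\<integral>\<omega>. norm (F \<omega>) \<partial>?P) \<le> 32 * (?G + ?H)"
        using r_le by blast
      then show "(\<integral>\<omega>. norm (F \<omega>) \<partial>?P) + (\<integral>\<omega>. (norm (0::'k))\<^sup>2 \<partial>?P) / r \<le> 32 * (?G + ?H)"
        by simp
    qed
    moreover have "(\<lambda>\<omega>. 0) \<in> first_order_sums M"
      using first_order_sumsI[where w = "\<lambda>_ _. 0" and M = M and n = 0] by simp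
    ultimately show ?thesis using F by (intro bexI[of _ F] bexI[of _ "\<lambda>\<omega>. 0"]) auto
  qed
qed

section \<open>Closures of subspaces of Lebesgue and Bochner spaces\<close>

lemma sum_fun_apply: "(\<Sum>i\<in>I. f i) x = (\<Sum>i\<in>I. f i x)"
  by (induction I rule: infinite_finite_induct) auto

lemma Lp_1_iff: "f \<in> Lp M 1 \<longleftrightarrow> integrable M f"
  unfolding Lp_def by (auto simp: integrable_norm_iff)

lemma Lp_2_iff: "f \<in> Lp M 2 \<longleftrightarrow> f \<in> borel_measurable M \<and> integrable M (\<lambda>x. (norm (f x))\<^sup>2)"
  unfolding Lp_def by simp

lemma Lp_norm_1: "Lp_norm M 1 f = (\<integral>x. norm (f x) \<partial>M)"
  unfolding Lp_norm_def by (simp add: Bochner_Integration.integral_nonneg)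

lemma Lp_norm_2: "Lp_norm M 2 f = sqrt (\<integral>x. (norm (f x))\<^sup>2 \<partial>M)"
  unfolding Lp_norm_def by (simp add: powr_half_sqrt Bochner_Integration.integral_nonneg)

lemma Lp_norm_nonneg: "0 \<le> Lp_norm M p f"
  unfolding Lp_norm_def by simp

lemma Lp_norm_powr:
  assumes "0 < p"
  shows "Lp_norm M p f powr p = (\<integral>x. norm (f x) powr p \<partial>M)"
  using assms unfolding Lp_norm_def by (simp add: powr_powr Bochner_Integration.integral_nonneg)

lemma Lp_scale:
  fixes f :: "'a \<Rightarrow> 'k::{real_normed_field, euclidean_space}"
  assumes "f \<in> Lp M p" "0 < p"
  shows "(\<lambda>x. c * f x) \<in> Lp M p" "Lp_norm M p (\<lambda>x. c * f x) = norm c * Lp_norm M p f"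
proof -
  show "(\<lambda>x. c * f x) \<in> Lp M p"
    using assms unfolding Lp_def by (auto simp: norm_mult powr_mult)
  show "Lp_norm M p (\<lambda>x. c * f x) = norm c * Lp_norm M p f"
    using assms unfolding Lp_norm_def
    by (simp add: norm_mult powr_mult powr_powr Bochner_Integration.integral_nonneg)
qed

text \<open>
  A quasi-triangle inequality with constant 4 suffices: constants are immaterial for density and for
  \<open>K\<close>-closedness.
\<close>

lemma Lp_add:
  fixes f g :: "'a \<Rightarrow> 'k::{banach, second_countable_topology}"
  assumes "f \<in> Lp M p" "g \<in> Lp M p" "1 \<le> p"
  shows "f + g \<in> Lp M p" "Lp_norm M p (f + g) \<le> 4 * (Lp_norm M p f + Lp_norm M p g)"
proof -
  have f[measurable]: "f \<in> borel_measurable M" and fi: "integrable M (\<lambda>x. norm (f x) powr p)"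
    and g[measurable]: "g \<in> borel_measurable M" and gi: "integrable M (\<lambda>x. norm (g x) powr p)"
    using assms by (auto simp: Lp_def)
  have pw: "norm (f x + g x) powr p \<le> 2 powr p * (norm (f x) powr p + norm (g x) powr p)" for x
  proof -
    have *: "(a + b) powr p \<le> 2 powr p * (a powr p + b powr p)" if "0 \<le> a" "a \<le> b" for a b :: real
    proof -
      have "(a + b) powr p \<le> (2 * b) powr p" using that assms by (intro powr_mono2) auto
      also have "\<dots> = 2 powr p * b powr p" using that by (simp add: powr_mult)
      also have "\<dots> \<le> 2 powr p * (a powr p + b powr p)" by (intro mult_left_mono) auto
      finally show ?thesis .
    qed
    have "norm (f x + g x) powr p \<le> (norm (f x) + norm (g x)) powr p"
      using assms by (intro powr_mono2) (auto intro: norm_triangle_ineq)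
    also have "\<dots> \<le> 2 powr p * (norm (f x) powr p + norm (g x) powr p)"
      using *[of "norm (f x)" "norm (g x)"] *[of "norm (g x)" "norm (f x)"]
      by (cases "norm (f x) \<le> norm (g x)") (auto simp: add.commute)
    finally show ?thesis .
  qed
  have int: "integrable M (\<lambda>x. 2 powr p * (norm (f x) powr p + norm (g x) powr p))"
    using fi gi by auto
  have sum_int: "integrable M (\<lambda>x. norm (f x + g x) powr p)"
    by (rule Bochner_Integration.integrable_bound[OF int])
      (auto intro!: AE_I2 order_trans[OF pw])
  show "f + g \<in> Lp M p"
    using sum_int by (simp add: Lp_def plus_fun_def)
  let ?I = "\<lambda>f. \<integral>x. norm (f x) powr p \<partial>M"
  have I0: "0 \<le> ?I f" for f :: "'a \<Rightarrow> 'k" by (simp add: Bochner_Integration.integral_nonneg)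
  have "?I (f + g) \<le> 2 powr p * (?I f + ?I g)"
    using integral_mono[OF sum_int int pw] fi gi by (simp add: plus_fun_def)
  then have norm_le: "Lp_norm M p (f + g) \<le> (2 powr p * (?I f + ?I g)) powr (1 / p)"
    unfolding Lp_norm_def using assms I0 by (intro powr_mono2) auto
  have *: "(2 powr p * (a + b)) powr (1 / p) \<le> 4 * (a powr (1 / p) + b powr (1 / p))"
    if "0 \<le> a" "a \<le> b" for a b :: real
  proof -
    have "(2 powr p * (a + b)) powr (1 / p) \<le> (2 powr p * (2 * b)) powr (1 / p)"
      using that assms by (intro powr_mono2) auto
    also have "\<dots> = 2 * (2 powr (1 / p) * b powr (1 / p))"
      using that assms by (simp add: powr_mult powr_powr)
    also have "\<dots> \<le> 2 * (2 * b powr (1 / p))"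
      using assms powr_mono[of "1 / p" 1 2] by (intro mult_left_mono mult_right_mono) auto
    also have "\<dots> \<le> 4 * (a powr (1 / p) + b powr (1 / p))" by simp
    finally show ?thesis .
  qed
  show "Lp_norm M p (f + g) \<le> 4 * (Lp_norm M p f + Lp_norm M p g)"
    using norm_le *[of "?I f" "?I g"] *[of "?I g" "?I f"] I0[of f] I0[of g]
    unfolding Lp_norm_def by (cases "?I f \<le> ?I g") (auto simp: add.commute)
qed

lemma Lp_diff:
  fixes f g :: "'a \<Rightarrow> 'k::{real_normed_field, euclidean_space}"
  assumes "f \<in> Lp M p" "g \<in> Lp M p" "1 \<le> p"
  shows "f - g \<in> Lp M p" "Lp_norm M p (f - g) \<le> 4 * (Lp_norm M p f + Lp_norm M p g)"
    "Lp_norm M p (f - g) = Lp_norm M p (g - f)"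
proof -
  have eq: "f - g = f + (\<lambda>x. (-1) * g x)" by (simp add: fun_eq_iff)
  have p: "0 < p" using assms by simp
  show "f - g \<in> Lp M p" unfolding eq
    using assms Lp_scale[OF assms(2) p, of "-1"] by (intro Lp_add) auto
  show "Lp_norm M p (f - g) \<le> 4 * (Lp_norm M p f + Lp_norm M p g)"
    unfolding eq using Lp_add(2)[OF assms(1) Lp_scale(1)[OF assms(2) p] assms(3), of "-1"]
      Lp_scale(2)[OF assms(2) p, of "-1"] by simp
  show "Lp_norm M p (f - g) = Lp_norm M p (g - f)"
    unfolding Lp_norm_def by (simp add: norm_minus_commute)
qed

lemma Lp_subspace:
  fixes M :: "'a measure"
  assumes "1 \<le> p"
  shows "fun_space.subspace (Lp M p :: ('a \<Rightarrow> 'k::{real_normed_field, euclidean_space}) set)"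
proof (rule fun_space.subspaceI)
  show "(0 :: 'a \<Rightarrow> 'k) \<in> Lp M p" by (simp add: Lp_def zero_fun_def)
  show "f + g \<in> Lp M p" if "f \<in> Lp M p" "g \<in> Lp M p" for f g :: "'a \<Rightarrow> 'k"
    using that assms by (rule Lp_add(1))
  show "(\<lambda>x. c * f x) \<in> Lp M p" if "f \<in> Lp M p" for c and f :: "'a \<Rightarrow> 'k"
    using that assms by (intro Lp_scale(1)) auto
qed

abbreviation Lp_closure ::
  "'a measure \<Rightarrow> real \<Rightarrow> ('a \<Rightarrow> 'k::{real_normed_field, euclidean_space}) set \<Rightarrow> ('a \<Rightarrow> 'k) set" where
  "Lp_closure M p \<equiv> closure_in (Lp M p) (Lp_norm M p)"

lemma Lp_closure_superset: "A \<subseteq> Lp M p \<Longrightarrow> A \<subseteq> Lp_closure M p A"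
proof
  fix f assume "A \<subseteq> Lp M p" "f \<in> A"
  moreover have "Lp_norm M p (f - f) = 0" by (simp add: Lp_norm_def)
  ultimately show "f \<in> Lp_closure M p A" by (force simp: closure_in_def)
qed

lemma Lp_closure_subset: "Lp_closure M p A \<subseteq> Lp M p"
  by (auto simp: closure_in_def)

lemma Lp_closureE:
  assumes "f \<in> Lp_closure M p A" "0 < e"
  obtains a where "a \<in> A" "Lp_norm M p (f - a) < e"
  using assms unfolding closure_in_def by auto

lemma Lp_closure_minimal:
  assumes A: "A \<subseteq> Lp M p" and B: "B \<subseteq> Lp_closure M p A" and p: "1 \<le> p"
  shows "Lp_closure M p B \<subseteq> Lp_closure M p A"
proof
  fix f assume f: "f \<in> Lp_closure M p B"
  then have fL: "f \<in> Lp M p" by (simp add: closure_in_def)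
  have "\<exists>a\<in>A. Lp_norm M p (f - a) < e" if e: "0 < e" for e
  proof -
    obtain b where b: "b \<in> B" "Lp_norm M p (f - b) < e / 8"
      using e by (auto intro: Lp_closureE[OF f, of "e / 8"])
    then have bA: "b \<in> Lp_closure M p A" using B by blast
    then obtain a where a: "a \<in> A" "Lp_norm M p (b - a) < e / 8"
      using e by (auto intro: Lp_closureE[OF bA, of "e / 8"])
    have L: "b \<in> Lp M p" "a \<in> Lp M p" using bA A a by (auto simp: closure_in_def)
    have "Lp_norm M p ((f - b) + (b - a)) \<le> 4 * (Lp_norm M p (f - b) + Lp_norm M p (b - a))"
      using L fL p by (intro Lp_add Lp_diff) auto
    then show ?thesis using a b by (intro bexI[of _ a]) auto
  qed
  then show "f \<in> Lp_closure M p A" using fL by (auto simp: closure_in_def)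
qed

lemma subspace_Lp_closure:
  fixes A :: "('a \<Rightarrow> 'k::{real_normed_field, euclidean_space}) set"
  assumes A: "A \<subseteq> Lp M p" "fun_space.subspace A" and p: "1 \<le> p"
  shows "fun_space.subspace (Lp_closure M p A)"
proof (rule fun_space.subspaceI)
  show "0 \<in> Lp_closure M p A"
    using Lp_closure_superset[OF A(1)] fun_space.subspace_0[OF A(2)] by blast
next
  fix f g assume fg: "f \<in> Lp_closure M p A" "g \<in> Lp_closure M p A"
  then have L: "f \<in> Lp M p" "g \<in> Lp M p" by (auto simp: closure_in_def)
  have "\<exists>a\<in>A. Lp_norm M p (f + g - a) < e" if e: "0 < e" for e
  proof -
    have e8: "0 < e / 8" using e by simp
    obtain a where a: "a \<in> A" "Lp_norm M p (f - a) < e / 8"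
      by (rule Lp_closureE[OF fg(1) e8])
    obtain b where b: "b \<in> A" "Lp_norm M p (g - b) < e / 8"
      by (rule Lp_closureE[OF fg(2) e8])
    note ab = a b
    have eq: "f + g - (a + b) = (f - a) + (g - b)" by simp
    have "Lp_norm M p ((f - a) + (g - b)) \<le> 4 * (Lp_norm M p (f - a) + Lp_norm M p (g - b))"
      using L A ab p by (intro Lp_add Lp_diff) auto
    also have "\<dots> < 4 * (e / 8 + e / 8)"
      using ab by (intro mult_strict_left_mono add_strict_mono) auto
    finally have "Lp_norm M p (f + g - (a + b)) < e"
      unfolding eq by simp
    then show ?thesis using fun_space.subspace_add[OF A(2) ab(1,3)] by blast
  qed
  then show "f + g \<in> Lp_closure M p A" using L p by (auto simp: closure_in_def Lp_add)
next
  fix c :: 'k and f assume f: "f \<in> Lp_closure M p A"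
  then have L: "f \<in> Lp M p" by (auto simp: closure_in_def)
  have p0: "0 < p" using p by simp
  have "\<exists>a\<in>A. Lp_norm M p ((\<lambda>x. c * f x) - a) < e" if e: "0 < e" for e
  proof -
    have "0 < e / (norm c + 1)" using e by (simp add: add_nonneg_pos)
    then obtain a where a: "a \<in> A" "Lp_norm M p (f - a) < e / (norm c + 1)"
      by (rule Lp_closureE[OF f])
    have "Lp_norm M p (\<lambda>x. c * (f - a) x) = norm c * Lp_norm M p (f - a)"
      using L A a p by (intro Lp_scale(2) Lp_diff(1)) auto
    also have "\<dots> \<le> (norm c + 1) * Lp_norm M p (f - a)"
      by (intro mult_right_mono) (auto simp: Lp_norm_nonneg)
    also have "\<dots> < e"
      using a pos_less_divide_eq[of "norm c + 1" "Lp_norm M p (f - a)" e]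
      by (simp add: add_nonneg_pos mult.commute)
    finally have "Lp_norm M p (\<lambda>x. c * (f - a) x) < e" .
    moreover have "(\<lambda>x. c * f x) - (\<lambda>x. c * a x) = (\<lambda>x. c * (f - a) x)"
      by (simp add: fun_eq_iff algebra_simps)
    ultimately show ?thesis using a fun_space.subspace_scale[OF A(2), of a c]
      by (intro bexI[of _ "\<lambda>x. c * a x"]) auto
  qed
  then show "(\<lambda>x. c * f x) \<in> Lp_closure M p A" using L p0 by (auto simp: closure_in_def Lp_scale)
qed

text \<open>
  By Fubini, the Bochner space of exponent \<open>p\<close> with values in \<open>L\<^sup>p\<close> is the \<open>L\<^sup>p\<close> space of the
  product measure. This makes the two factors interchangeable, so that decompositions may be carried out at fixed \<open>x\<close>.
\<close>

lemma Bochner_eq_Lp: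
  fixes P :: "'a measure" and N :: "'b measure"
  assumes "sigma_finite_measure P" "sigma_finite_measure N" and p: "0 < p"
  shows "Bochner P N p = (Lp (P \<Otimes>\<^sub>M N) p :: ('a \<times> 'b \<Rightarrow> 'k::{banach, second_countable_topology}) set)"
proof -
  interpret pair_sigma_finite P N using assms by (simp add: pair_sigma_finite_def)
  have "f \<in> Bochner P N p \<longleftrightarrow> f \<in> Lp (P \<Otimes>\<^sub>M N) p" for f :: "'a \<times> 'b \<Rightarrow> 'k"
  proof (cases "f \<in> borel_measurable (P \<Otimes>\<^sub>M N)")
    case True
    then have [measurable]: "f \<in> borel_measurable (P \<Otimes>\<^sub>M N)" .
    have sec: "(\<lambda>x. f (\<omega>, x)) \<in> Lp N p \<longleftrightarrow> integrable N (\<lambda>x. norm (f (\<omega>, x)) powr p)" if "\<omega> \<in> space P" for \<omega>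
      using that by (auto simp: Lp_def)
    have "(AE \<omega> in P. (\<lambda>x. f (\<omega>, x)) \<in> Lp N p) \<longleftrightarrow> (AE \<omega> in P. integrable N (\<lambda>x. norm (f (\<omega>, x)) powr p))"
      using sec by (intro AE_cong) auto
    moreover have "(\<lambda>\<omega>. Lp_norm N p (\<lambda>x. f (\<omega>, x))) \<in> Lp P p \<longleftrightarrow>
        integrable P (\<lambda>\<omega>. \<integral>x. norm (f (\<omega>, x)) powr p \<partial>N)"
      using measurable_section_norm[OF assms(2) True]
      by (simp add: Lp_def Lp_norm_nonneg Lp_norm_powr[OF p])
    moreover have "integrable (P \<Otimes>\<^sub>M N) (\<lambda>z. norm (f z) powr p) \<longleftrightarrow>
        (AE \<omega> in P. integrable N (\<lambda>x. norm (f (\<omega>, x)) powr p)) \<and>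
        integrable P (\<lambda>\<omega>. \<integral>x. norm (f (\<omega>, x)) powr p \<partial>N)" (is "?L \<longleftrightarrow> ?R1 \<and> ?R2")
    proof
      assume ?L
      then show "?R1 \<and> ?R2"
        using AE_integrable_fst'[of "\<lambda>z. norm (f z) powr p"] integrable_fst'[of "\<lambda>z. norm (f z) powr p"]
        by simp
    next
      assume "?R1 \<and> ?R2"
      then show ?L by (intro Fubini_integrable) simp_all
    qed
    ultimately show ?thesis using True unfolding Bochner_def Lp_def[of "P \<Otimes>\<^sub>M N"] by simp
  qed (auto simp: Bochner_def Lp_def)
  then show ?thesis by blast
qed

lemma Bochner_norm_eq_Lp_norm:
  fixes P :: "'a measure" and N :: "'b measure" and f :: "'a \<times> 'b \<Rightarrow> 'k::{banach, second_countable_topology}"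
  assumes "sigma_finite_measure P" "sigma_finite_measure N" and p: "0 < p"
    and f: "f \<in> Lp (P \<Otimes>\<^sub>M N) p"
  shows "Bochner_norm P N p f = Lp_norm (P \<Otimes>\<^sub>M N) p f"
proof -
  interpret pair_sigma_finite P N using assms by (simp add: pair_sigma_finite_def)
  have "integrable (P \<Otimes>\<^sub>M N) (\<lambda>z. norm (f z) powr p)" using f by (simp add: Lp_def)
  from integral_fst'[OF this] show ?thesis
    unfolding Bochner_norm_def Lp_norm_def[of P] Lp_norm_def[of "P \<Otimes>\<^sub>M N"]
    by (simp add: Lp_norm_nonneg Lp_norm_powr[OF p])
qed

lemma closure_in_Bochner:
  fixes A :: "('a \<times> 'b \<Rightarrow> 'k::{real_normed_field, euclidean_space}) set"
  assumes P: "sigma_finite_measure P" and N: "sigma_finite_measure N" and p: "1 \<le> p"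
    and A: "A \<subseteq> Lp (P \<Otimes>\<^sub>M N) p"
  shows "closure_in (Bochner P N p) (Bochner_norm P N p) A = Lp_closure (P \<Otimes>\<^sub>M N) p A"
proof -
  have "Bochner_norm P N p (f - g) = Lp_norm (P \<Otimes>\<^sub>M N) p (f - g)"
    if "f \<in> Lp (P \<Otimes>\<^sub>M N) p" "g \<in> A" for f g
    using that A p by (intro Bochner_norm_eq_Lp_norm P N Lp_diff) auto
  then show ?thesis
    using p by (auto simp: closure_in_def Bochner_eq_Lp[OF P N])
qed

section \<open>First order sums are dense in the scalar spaces\<close>

context prob_space
begin

lemma first_order_sums_subset_Lp2: "first_order_sums M \<subseteq> Lp (infinite_power M) 2"
  using first_order_sums_square_integrable by (auto simp: Lp_2_iff)

lemma subspace_first_order_sums: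
  "fun_space.subspace (first_order_sums M :: ((nat \<Rightarrow> 'a) \<Rightarrow> 'k::{real_normed_field, euclidean_space}) set)"
proof (rule fun_space.subspaceI)
  show "(0 :: (nat \<Rightarrow> 'a) \<Rightarrow> 'k) \<in> first_order_sums M"
    using first_order_sumsI[where w = "\<lambda>_ _. 0::'k" and M = M and n = 0] by (simp add: zero_fun_def)
next
  fix F G :: "(nat \<Rightarrow> 'a) \<Rightarrow> 'k"
  assume FG: "F \<in> first_order_sums M" "G \<in> first_order_sums M"
  obtain n w where F_eq: "F = (\<lambda>\<omega>. \<Sum>k<n. w k (\<omega> k))"
    and w[measurable]: "\<And>k. w k \<in> borel_measurable M"
    and w2: "\<And>k. integrable M (\<lambda>y. (norm (w k y))\<^sup>2)" "\<And>k. (\<integral>y. w k y \<partial>M) = 0"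
    by (rule first_order_sumsE[OF FG(1)]) blast
  obtain m v where G_eq: "G = (\<lambda>\<omega>. \<Sum>k<m. v k (\<omega> k))"
    and v[measurable]: "\<And>k. v k \<in> borel_measurable M"
    and v2: "\<And>k. integrable M (\<lambda>y. (norm (v k y))\<^sup>2)" "\<And>k. (\<integral>y. v k y \<partial>M) = 0"
    by (rule first_order_sumsE[OF FG(2)]) blast
  define a where "a k y = (if k < n then w k y else 0)" for k y
  define b where "b k y = (if k < m then v k y else 0)" for k y
  have a: "a k \<in> borel_measurable M" "integrable M (\<lambda>y. (norm (a k y))\<^sup>2)" "(\<integral>y. a k y \<partial>M) = 0" for k
    using w2 by (cases "k < n"; simp add: a_def[abs_def])+
  have b: "b k \<in> borel_measurable M" "integrable M (\<lambda>y. (norm (b k y))\<^sup>2)" "(\<integral>y. b k y \<partial>M) = 0" for k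
    using v2 by (cases "k < m"; simp add: b_def[abs_def])+
  have "(\<Sum>k<n. w k (\<omega> k)) = (\<Sum>k<max n m. a k (\<omega> k))" for \<omega>
    by (rule sum.mono_neutral_cong_left) (auto simp: a_def)
  moreover have "(\<Sum>k<m. v k (\<omega> k)) = (\<Sum>k<max n m. b k (\<omega> k))" for \<omega>
    by (rule sum.mono_neutral_cong_left) (auto simp: b_def)
  ultimately have "F + G = (\<lambda>\<omega>. \<Sum>k<max n m. a k (\<omega> k) + b k (\<omega> k))"
    by (simp add: F_eq G_eq plus_fun_def sum.distrib)
  also have "\<dots> \<in> first_order_sums M"
  proof (rule first_order_sumsI[where w = "\<lambda>k y. a k y + b k y"])
    show "(\<integral>y. a k y + b k y \<partial>M) = 0" for k
      using a(3) b(3) integrable_of_square[OF a(1,2)] integrable_of_square[OF b(1,2)] by simp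
  qed (use a b in \<open>auto intro: integrable_add_square\<close>)
  finally show "F + G \<in> first_order_sums M" .
next
  fix c and F :: "(nat \<Rightarrow> 'a) \<Rightarrow> 'k"
  assume F: "F \<in> first_order_sums M"
  obtain n w where F_eq: "F = (\<lambda>\<omega>. \<Sum>k<n. w k (\<omega> k))"
    and w[measurable]: "\<And>k. w k \<in> borel_measurable M"
    and w2: "\<And>k. integrable M (\<lambda>y. (norm (w k y))\<^sup>2)" "\<And>k. (\<integral>y. w k y \<partial>M) = 0"
    by (rule first_order_sumsE[OF F]) blast
  have "(\<lambda>\<omega>. \<Sum>k<n. c * w k (\<omega> k)) \<in> first_order_sums M"
    using w2 by (intro first_order_sumsI[where w = "\<lambda>k y. c * w k y"])
      (auto simp: norm_mult power_mult_distrib)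
  then show "(\<lambda>\<omega>. c * F \<omega>) \<in> first_order_sums M" by (simp add: F_eq sum_distrib_left)
qed

lemma first_order_single:
  fixes w :: "'a \<Rightarrow> 'k::euclidean_space"
  assumes "w \<in> borel_measurable M" "integrable M (\<lambda>y. (norm (w y))\<^sup>2)" "(\<integral>y. w y \<partial>M) = 0"
  shows "(\<lambda>\<omega>. w (\<omega> j)) \<in> first_order_sums M"
proof -
  have "(\<lambda>\<omega>. \<Sum>k<Suc j. (if k = j then w (\<omega> k) else 0)) \<in> first_order_sums M"
  proof (rule first_order_sumsI[where w = "\<lambda>k y. if k = j then w y else 0"])
    fix k
    show "(\<lambda>y. if k = j then w y else 0) \<in> borel_measurable M"
      "integrable M (\<lambda>y. (norm (if k = j then w y else 0))\<^sup>2)"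
      "(\<integral>y. (if k = j then w y else 0) \<partial>M) = 0"
      using assms by (cases "k = j"; simp)+
  qed
  then show ?thesis by (simp add: sum.delta)
qed

lemma integral_first_order_sum:
  fixes F :: "(nat \<Rightarrow> 'a) \<Rightarrow> 'k::euclidean_space"
  assumes F: "F \<in> first_order_sums M"
  shows "(\<integral>\<omega>. F \<omega> \<partial>infinite_power M) = 0"
proof -
  obtain n w where F_eq: "F = (\<lambda>\<omega>. \<Sum>k<n. w k (\<omega> k))"
    and w[measurable]: "\<And>k. w k \<in> borel_measurable M"
    and w2: "\<And>k. integrable M (\<lambda>y. (norm (w k y))\<^sup>2)" "\<And>k. (\<integral>y. w k y \<partial>M) = 0"
    by (rule first_order_sumsE[OF F]) blast
  have "integrable M (w k)" for k by (rule integrable_of_square[OF w w2(1)])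
  then show ?thesis
    unfolding F_eq using w2(2) by (simp add: integrable_coordinate integral_coordinate)
qed

text \<open>
  Functions depending on no coordinate are constant on the underlying space, hence so are their
  linear combinations; a limit of them is approximated by constants.
\<close>

lemma U2_le_0_constant:
  fixes g :: "(nat \<Rightarrow> 'a) \<Rightarrow> 'k::{real_normed_field, euclidean_space}"
  assumes g: "g \<in> U2_le M 0" and e: "0 < e"
  obtains c where "integrable (infinite_power M) (\<lambda>\<omega>. (norm (g \<omega> - c))\<^sup>2)"
    "(\<integral>\<omega>. (norm (g \<omega> - c))\<^sup>2 \<partial>infinite_power M) < e"
proof -
  let ?P = "infinite_power M"
  interpret P: prob_space ?P by (rule prob_space_infinite_power) (rule prob_space_axioms)
  let ?C = "{s \<in> Lp ?P 2. \<exists>c::'k. \<forall>\<omega>\<in>space ?P. s \<omega> = c}"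
  have "fun_space.span {f \<in> Lp ?P 2. \<exists>J. finite J \<and> card J \<le> 0 \<and> depends_on M J f} \<subseteq> ?C"
  proof (rule fun_space.span_minimal)
    obtain \<omega>0 where "\<omega>0 \<in> space ?P" using P.not_empty by blast
    then have "s \<omega> = s \<omega>0" if "finite J" "card J \<le> 0" "depends_on M J s" "\<omega> \<in> space ?P"
      for s :: "(nat \<Rightarrow> 'a) \<Rightarrow> 'k" and J \<omega>
    proof -
      have "J = {}" using that by simp
      then show ?thesis using that \<open>\<omega>0 \<in> space ?P\<close> unfolding depends_on_def by blast
    qed
    then show "{f \<in> Lp ?P 2. \<exists>J. finite J \<and> card J \<le> 0 \<and> depends_on M J f} \<subseteq> ?C"
      by blast
    have sub: "fun_space.subspace (Lp ?P 2 :: ((nat \<Rightarrow> 'a) \<Rightarrow> 'k) set)" by (rule Lp_subspace) simp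
    show "fun_space.subspace ?C"
    proof (rule fun_space.subspaceI)
      show "0 \<in> ?C" using fun_space.subspace_0[OF sub] by auto
    next
      fix f h assume fh: "f \<in> ?C" "h \<in> ?C"
      then obtain c d where "\<forall>\<omega>\<in>space ?P. f \<omega> = c" "\<forall>\<omega>\<in>space ?P. h \<omega> = d" by blast
      then show "f + h \<in> ?C"
        using fh fun_space.subspace_add[OF sub, of f h] by (auto intro!: exI[of _ "c + d"])
    next
      fix a f assume f: "f \<in> ?C"
      then obtain c where "\<forall>\<omega>\<in>space ?P. f \<omega> = c" by blast
      then show "(\<lambda>x. a * f x) \<in> ?C"
        using f fun_space.subspace_scale[OF sub, of f a] by (auto intro!: exI[of _ "a * c"])
    qed
  qed
  moreover obtain s where s: "s \<in> fun_space.span {f \<in> Lp ?P 2. \<exists>J. finite J \<and> card J \<le> 0 \<and> depends_on M J f}"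
    and less: "Lp_norm ?P 2 (g - s) < sqrt e"
    using Lp_closureE[OF g[unfolded U2_le_def], of "sqrt e"] e by auto
  ultimately obtain c where sL: "s \<in> Lp ?P 2" and c: "\<And>\<omega>. \<omega> \<in> space ?P \<Longrightarrow> s \<omega> = c" by auto
  have "g \<in> Lp ?P 2" using g by (simp add: U2_le_def closure_in_def)
  then have "g - s \<in> Lp ?P 2" using sL by (rule Lp_diff(1)) simp
  then have "integrable ?P (\<lambda>\<omega>. (norm ((g - s) \<omega>))\<^sup>2)" by (simp add: Lp_2_iff)
  moreover have "integrable ?P (\<lambda>\<omega>. (norm ((g - s) \<omega>))\<^sup>2) \<longleftrightarrow> integrable ?P (\<lambda>\<omega>. (norm (g \<omega> - c))\<^sup>2)"
    by (rule Bochner_Integration.integrable_cong) (auto simp: c)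
  moreover have "(\<integral>\<omega>. (norm ((g - s) \<omega>))\<^sup>2 \<partial>?P) = (\<integral>\<omega>. (norm (g \<omega> - c))\<^sup>2 \<partial>?P)"
    by (rule Bochner_Integration.integral_cong) (auto simp: c)
  ultimately show thesis using less that by (simp add: Lp_norm_2)
qed

text \<open>
  Orthogonality to limits of constants: \<open>F\<close> has mean zero, so subtracting a constant from \<open>g\<close> does
  not change the pairing, and Young's inequality with a free parameter makes it arbitrarily small.
\<close>

lemma first_order_sums_subset_U2_1:
  "(first_order_sums M :: ((nat \<Rightarrow> 'a) \<Rightarrow> 'k::{real_normed_field, euclidean_space}) set) \<subseteq> U2_1 M"
proof
  let ?P = "infinite_power M"
  interpret P: prob_space ?P by (rule prob_space_infinite_power) (rule prob_space_axioms)
  let ?G = "{f \<in> Lp ?P 2. \<exists>J. finite J \<and> card J \<le> 1 \<and> depends_on M J f} :: ((nat \<Rightarrow> 'a) \<Rightarrow> 'k) set"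
  fix F :: "(nat \<Rightarrow> 'a) \<Rightarrow> 'k" assume F: "F \<in> first_order_sums M"
  have FL: "F \<in> Lp ?P 2" using F first_order_sums_subset_Lp2 by blast
  note F_int = first_order_sums_square_integrable[OF F]
  obtain n w where F_eq: "F = (\<lambda>\<omega>. \<Sum>k<n. w k (\<omega> k))"
    and w[measurable]: "\<And>k. w k \<in> borel_measurable M"
    and w2: "\<And>k. integrable M (\<lambda>y. (norm (w k y))\<^sup>2)" "\<And>k. (\<integral>y. w k y \<partial>M) = 0"
    by (rule first_order_sumsE[OF F]) blast
  have "(\<lambda>\<omega>. w k (\<omega> k)) \<in> ?G" for k
    using first_order_single[OF w w2] first_order_sums_subset_Lp2
    by (auto intro!: exI[of _ "{k}"] simp: depends_on_def)
  then have "(\<Sum>k<n. (\<lambda>\<omega>. w k (\<omega> k))) \<in> fun_space.span ?G"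
    by (intro fun_space.span_sum fun_space.span_base)
  moreover have "(\<Sum>k<n. (\<lambda>\<omega>. w k (\<omega> k))) = F"
    by (simp add: F_eq fun_eq_iff sum_fun_apply)
  ultimately have "F \<in> fun_space.span ?G" by simp
  moreover have "fun_space.span ?G \<subseteq> Lp ?P 2"
    by (rule fun_space.span_minimal) (auto intro: Lp_subspace)
  ultimately have U2: "F \<in> U2_le M 1"
    unfolding U2_le_def using Lp_closure_superset by blast
  have "(\<integral>\<omega>. inner (F \<omega>) (g \<omega>) \<partial>?P) = 0" if g: "g \<in> U2_le M 0" for g
  proof -
    let ?x = "\<bar>\<integral>\<omega>. inner (F \<omega>) (g \<omega>) \<partial>?P\<bar>" and ?A = "\<integral>\<omega>. (norm (F \<omega>))\<^sup>2 \<partial>?P"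
    have gL: "g \<in> borel_measurable ?P" "integrable ?P (\<lambda>\<omega>. (norm (g \<omega>))\<^sup>2)"
      using g by (simp_all add: U2_le_def closure_in_def Lp_2_iff)
    have A0: "0 \<le> ?A" by (simp add: Bochner_Integration.integral_nonneg)
    have bound: "?x \<le> t * ?A + d" if t: "0 < t" and d: "0 < d" for t d
    proof -
      obtain c where c: "integrable ?P (\<lambda>\<omega>. (norm (g \<omega> - c))\<^sup>2)" "(\<integral>\<omega>. (norm (g \<omega> - c))\<^sup>2 \<partial>?P) < 4 * t * d"
        using U2_le_0_constant[OF g, of "4 * t * d"] t d by auto
      have F_g: "integrable ?P (\<lambda>\<omega>. inner (F \<omega>) (g \<omega>))"
        by (rule integrable_inner_square) (use F_int gL in auto)
      have "(\<integral>\<omega>. inner (F \<omega>) (g \<omega>) \<partial>?P) = (\<integral>\<omega>. inner (F \<omega>) (g \<omega> - c) \<partial>?P)"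
        using F_int F_g integral_first_order_sum[OF F] by (simp add: inner_diff_right)
      then have "?x = norm (\<integral>\<omega>. inner (F \<omega>) (g \<omega> - c) \<partial>?P)" by simp
      also have "\<dots> \<le> (\<integral>\<omega>. norm (inner (F \<omega>) (g \<omega> - c)) \<partial>?P)" by (rule integral_norm_bound)
      also have "\<dots> \<le> (\<integral>\<omega>. t * (norm (F \<omega>))\<^sup>2 + (norm (g \<omega> - c))\<^sup>2 / (4 * t) \<partial>?P)"
      proof (rule integral_mono)
        show "integrable ?P (\<lambda>\<omega>. norm (inner (F \<omega>) (g \<omega> - c)))"
          using F_int F_g by (simp add: inner_diff_right)
        show "integrable ?P (\<lambda>\<omega>. t * (norm (F \<omega>))\<^sup>2 + (norm (g \<omega> - c))\<^sup>2 / (4 * t))"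
          using F_int c by simp
        fix \<omega>
        have "norm (inner (F \<omega>) (g \<omega> - c)) \<le> norm (F \<omega>) * norm (g \<omega> - c)"
          by (simp add: Cauchy_Schwarz_ineq2)
        also have "\<dots> \<le> t * (norm (F \<omega>))\<^sup>2 + (norm (g \<omega> - c))\<^sup>2 / (4 * t)"
        proof -
          have "0 \<le> (2 * t * norm (F \<omega>) - norm (g \<omega> - c))\<^sup>2 / (4 * t)" using t by simp
          also have "\<dots> = t * (norm (F \<omega>))\<^sup>2 + (norm (g \<omega> - c))\<^sup>2 / (4 * t) - norm (F \<omega>) * norm (g \<omega> - c)"
            using t by (simp add: field_simps power2_eq_square)
          finally show ?thesis by simp
        qed
        finally show "norm (inner (F \<omega>) (g \<omega> - c)) \<le> t * (norm (F \<omega>))\<^sup>2 + (norm (g \<omega> - c))\<^sup>2 / (4 * t)" .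
      qed
      also have "\<dots> = t * ?A + (\<integral>\<omega>. (norm (g \<omega> - c))\<^sup>2 \<partial>?P) / (4 * t)"
        using F_int c by simp
      also have "(\<integral>\<omega>. (norm (g \<omega> - c))\<^sup>2 \<partial>?P) / (4 * t) \<le> d"
        using c t by (simp add: field_simps)
      finally show ?thesis by simp
    qed
    have "?x \<le> 0 + e" if "0 < e" for e
    proof -
      have "e / (2 * (a + 1)) * a \<le> e / 2" if "0 \<le> a" for a :: real
        using that \<open>0 < e\<close> by (simp add: divide_simps)
      note small = this[OF A0]
      have "?x \<le> e / (2 * (?A + 1)) * ?A + e / 2"
        using that A0 by (intro bound) (simp_all add: add_nonneg_pos)
      also have "\<dots> \<le> e / 2 + e / 2" by (rule add_right_mono[OF small])
      finally show ?thesis by simp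
    qed
    then have "?x \<le> 0" by (rule field_le_epsilon)
    then show ?thesis by simp
  qed
  then show "F \<in> U2_1 M" using U2 FL by (auto simp: U2_1_def orth_complement_def)
qed

text \<open>
  A function of at most one coordinate is a centred function of that coordinate plus its mean. So an
  approximant of \<open>u\<close> from the span has the form \<open>F + c\<close> with a first order sum \<open>F\<close>. Since \<open>u\<close> and
  \<open>F\<close> have mean zero, \<open>u - F\<close> is the centred error and is no larger than the error itself.
\<close>

lemma U2_1_subset_closure:
  "(U2_1 M :: ((nat \<Rightarrow> 'a) \<Rightarrow> 'k::{real_normed_field, euclidean_space}) set)
    \<subseteq> Lp_closure (infinite_power M) 2 (first_order_sums M)"
proof
  let ?P = "infinite_power M"
  interpret P: prob_space ?P by (rule prob_space_infinite_power) (rule prob_space_axioms)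
  let ?G = "{f \<in> Lp ?P 2. \<exists>J. finite J \<and> card J \<le> 1 \<and> depends_on M J f} :: ((nat \<Rightarrow> 'a) \<Rightarrow> 'k) set"
  let ?S = "{s \<in> Lp ?P 2. \<exists>F\<in>first_order_sums M. \<exists>c::'k. \<forall>\<omega>\<in>space ?P. s \<omega> = F \<omega> + c}"
  obtain \<omega>0 where \<omega>0: "\<omega>0 \<in> space ?P" using P.not_empty by blast
  have "v \<in> ?S" if vG: "v \<in> ?G" for v
  proof -
    from vG obtain J where v: "v \<in> Lp ?P 2" and J: "finite J" "card J \<le> 1" "depends_on M J v" by blast
    obtain j where "J \<subseteq> {j}"
      using J(1,2) by (metis card_1_singletonE card_0_eq empty_subsetI le_neq_implies_less less_one subset_refl)
    then have dep: "v \<omega> = v \<omega>'" if "\<omega> \<in> space ?P" "\<omega>' \<in> space ?P" "\<omega> j = \<omega>' j" for \<omega> \<omega>'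
      using J(3) that unfolding depends_on_def by blast
    \<comment> \<open>Freezing all coordinates but \<open>j\<close> exhibits \<open>v\<close> as a measurable function of that coordinate.\<close>
    define w where "w y = v (\<omega>0(j := y))" for y
    have upd: "(\<lambda>y. \<omega>0(j := y)) \<in> measurable M ?P"
      by (rule measurable_fun_upd[where J = UNIV]) (use \<omega>0 in auto)
    have v_eq: "v \<omega> = w (\<omega> j)" if "\<omega> \<in> space ?P" for \<omega>
      unfolding w_def using that \<omega>0 by (intro dep) (auto simp: space_PiM PiE_def Pi_iff)
    have vm[measurable]: "v \<in> borel_measurable ?P" and v2: "integrable ?P (\<lambda>\<omega>. (norm (v \<omega>))\<^sup>2)"
      using v by (auto simp: Lp_2_iff)
    have wm[measurable]: "w \<in> borel_measurable M"
      unfolding w_def[abs_def] by (rule measurable_compose[OF upd vm])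
    have "integrable ?P (\<lambda>\<omega>. (norm (w (\<omega> j)))\<^sup>2)"
      using v2 by (rule Bochner_Integration.integrable_cong[THEN iffD1, rotated -1]) (auto simp: v_eq)
    then have "integrable (distr ?P M (\<lambda>\<omega>. \<omega> j)) (\<lambda>y. (norm (w y))\<^sup>2)"
      by (subst integrable_distr_eq) auto
    then have w2: "integrable M (\<lambda>y. (norm (w y))\<^sup>2)"
      by (subst (asm) distr_PiM_component) (auto simp: prob_space_axioms)
    have "(\<lambda>\<omega>. w (\<omega> j) - (\<integral>y. w y \<partial>M)) \<in> first_order_sums M"
      using square_norm_centred(1)[OF wm w2] integrable_of_square[OF wm w2]
      by (intro first_order_single[where w = "\<lambda>y. w y - (\<integral>y. w y \<partial>M)"]) (auto simp: prob_space)
    then show ?thesis using v v_eq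
      by (auto intro!: bexI[of _ "\<lambda>\<omega>. w (\<omega> j) - (\<integral>y. w y \<partial>M)"] exI[of _ "\<integral>y. w y \<partial>M"])
  qed
  then have "?G \<subseteq> ?S" by blast
  moreover have "fun_space.subspace ?S"
  proof -
    have sub: "fun_space.subspace (Lp ?P 2 :: ((nat \<Rightarrow> 'a) \<Rightarrow> 'k) set)" by (rule Lp_subspace) simp
    note sub' = subspace_first_order_sums[where 'k = 'k]
    show ?thesis
    proof (rule fun_space.subspaceI)
      show "0 \<in> ?S"
        using fun_space.subspace_0[OF sub] fun_space.subspace_0[OF sub'] by (auto intro!: bexI[of _ 0] exI[of _ 0])
    next
      fix f h assume fh: "f \<in> ?S" "h \<in> ?S"
      then obtain F c H d where "F \<in> first_order_sums M" "\<forall>\<omega>\<in>space ?P. f \<omega> = F \<omega> + c"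
        "H \<in> first_order_sums M" "\<forall>\<omega>\<in>space ?P. h \<omega> = H \<omega> + d" by blast
      then show "f + h \<in> ?S"
        using fh fun_space.subspace_add[OF sub, of f h] fun_space.subspace_add[OF sub', of F H]
        by (auto intro!: bexI[of _ "F + H"] exI[of _ "c + d"])
    next
      fix a f assume f: "f \<in> ?S"
      then obtain F c where "F \<in> first_order_sums M" "\<forall>\<omega>\<in>space ?P. f \<omega> = F \<omega> + c" by blast
      then show "(\<lambda>\<omega>. a * f \<omega>) \<in> ?S"
        using f fun_space.subspace_scale[OF sub, of f a] fun_space.subspace_scale[OF sub', of F a]
        by (auto intro!: bexI[of _ "\<lambda>\<omega>. a * F \<omega>"] exI[of _ "a * c"] simp: distrib_left)
    qed
  qed
  ultimately have span: "fun_space.span ?G \<subseteq> ?S" by (rule fun_space.span_minimal)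
  fix u :: "(nat \<Rightarrow> 'a) \<Rightarrow> 'k" assume u: "u \<in> U2_1 M"
  then have uL: "u \<in> Lp ?P 2" and uU: "u \<in> U2_le M 1"
    and orth: "\<And>g. g \<in> U2_le M 0 \<Longrightarrow> (\<integral>\<omega>. inner (u \<omega>) (g \<omega>) \<partial>?P) = 0"
    by (auto simp: U2_1_def orth_complement_def)
  have um[measurable]: "u \<in> borel_measurable ?P" and u2: "integrable ?P (\<lambda>\<omega>. (norm (u \<omega>))\<^sup>2)"
    using uL by (auto simp: Lp_2_iff)
  have u_int: "integrable ?P u" by (rule P.integrable_of_square[OF um u2])
  have const: "(\<lambda>\<omega>. c) \<in> U2_le M 0" for c :: 'k
  proof -
    let ?G0 = "{f \<in> Lp ?P 2. \<exists>J. finite J \<and> card J \<le> 0 \<and> depends_on M J f} :: ((nat \<Rightarrow> 'a) \<Rightarrow> 'k) set"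
    have "(\<lambda>\<omega>. c) \<in> ?G0" by (auto simp: Lp_2_iff depends_on_def intro!: exI[of _ "{}"])
    then have "(\<lambda>\<omega>. c) \<in> fun_space.span ?G0" by (rule fun_space.span_base)
    moreover have "fun_space.span ?G0 \<subseteq> Lp ?P 2"
      by (rule fun_space.span_minimal) (auto intro: Lp_subspace)
    ultimately show ?thesis unfolding U2_le_def using Lp_closure_superset by blast
  qed
  have u_mean: "(\<integral>\<omega>. u \<omega> \<partial>?P) = 0"
    using orth[OF const, of "\<integral>\<omega>. u \<omega> \<partial>?P"] u_int by simp
  have "\<exists>F\<in>first_order_sums M. Lp_norm ?P 2 (u - F) < e" if e: "0 < e" for e
  proof -
    obtain s where s: "s \<in> fun_space.span ?G" "Lp_norm ?P 2 (u - s) < e"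
      using Lp_closureE[OF uU[unfolded U2_le_def] e] by blast
    then obtain F c where F: "F \<in> first_order_sums M" and sL: "s \<in> Lp ?P 2"
      and s_eq: "\<And>\<omega>. \<omega> \<in> space ?P \<Longrightarrow> s \<omega> = F \<omega> + c" using span by blast
    have sm[measurable]: "s \<in> borel_measurable ?P" and s2: "integrable ?P (\<lambda>\<omega>. (norm (s \<omega>))\<^sup>2)"
      using sL by (auto simp: Lp_2_iff)
    have "u - s \<in> Lp ?P 2" using uL sL by (rule Lp_diff(1)) simp
    then have d: "(\<lambda>\<omega>. u \<omega> - s \<omega>) \<in> borel_measurable ?P" "integrable ?P (\<lambda>\<omega>. (norm (u \<omega> - s \<omega>))\<^sup>2)"
      by (auto simp: Lp_2_iff)
    have "(\<integral>\<omega>. s \<omega> \<partial>?P) = (\<integral>\<omega>. F \<omega> + c \<partial>?P)"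
      by (rule Bochner_Integration.integral_cong) (auto simp: s_eq)
    also have "\<dots> = c"
      using first_order_sums_square_integrable(3)[OF F] integral_first_order_sum[OF F]
      by (simp add: P.prob_space)
    finally have mean: "(\<integral>\<omega>. u \<omega> - s \<omega> \<partial>?P) = - c"
      using u_int u_mean P.integrable_of_square[OF sm s2] by simp
    have "(\<integral>\<omega>. (norm (u \<omega> - F \<omega>))\<^sup>2 \<partial>?P)
        = (\<integral>\<omega>. (norm (u \<omega> - s \<omega> - (\<integral>\<omega>. u \<omega> - s \<omega> \<partial>?P)))\<^sup>2 \<partial>?P)"
      unfolding mean by (rule Bochner_Integration.integral_cong) (auto simp: s_eq)
    also have "\<dots> \<le> (\<integral>\<omega>. (norm (u \<omega> - s \<omega>))\<^sup>2 \<partial>?P)"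
      by (rule P.square_norm_centred(2)[OF d])
    finally have "Lp_norm ?P 2 (u - F) \<le> Lp_norm ?P 2 (u - s)" by (simp add: Lp_norm_2)
    then show ?thesis using s F by (intro bexI[of _ F]) auto
  qed
  then show "u \<in> Lp_closure ?P 2 (first_order_sums M)" using uL by (auto simp: closure_in_def)
qed

lemma Lp_2_into_Lp_1:
  fixes f :: "'a \<Rightarrow> 'k::{banach, second_countable_topology}"
  assumes f: "f \<in> Lp M 2"
  shows "f \<in> Lp M 1" "Lp_norm M 1 f \<le> Lp_norm M 2 f"
proof -
  have [measurable]: "f \<in> borel_measurable M" and f2: "integrable M (\<lambda>x. (norm (f x))\<^sup>2)"
    using f by (auto simp: Lp_2_iff)
  have f1: "integrable M f" by (rule integrable_of_square[OF _ f2]) measurable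
  then show "f \<in> Lp M 1" by (simp add: Lp_1_iff)
  have "0 \<le> variance (\<lambda>x. norm (f x))" by (rule variance_positive)
  also have "\<dots> = (\<integral>x. (norm (f x))\<^sup>2 \<partial>M) - (\<integral>x. norm (f x) \<partial>M)\<^sup>2"
    using f1 f2 by (intro variance_eq) auto
  finally show "Lp_norm M 1 f \<le> Lp_norm M 2 f"
    unfolding Lp_norm_1 Lp_norm_2 by (intro real_le_rsqrt) simp
qed

lemma first_order_sums_subset_Lp1: "first_order_sums M \<subseteq> Lp (infinite_power M) 1"
  using first_order_sums_square_integrable by (auto simp: Lp_1_iff)

text \<open>
  On a probability space, convergence in \<open>L\<^sup>2\<close> implies convergence in \<open>L\<^sup>1\<close>, so the density just
  proved carries over to the \<open>L\<^sup>1\<close> closure.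
\<close>

lemma U1_1_eq:
  "(U1_1 M :: ((nat \<Rightarrow> 'a) \<Rightarrow> 'k::{real_normed_field, euclidean_space}) set)
    = Lp_closure (infinite_power M) 1 (first_order_sums M)"
proof
  let ?P = "infinite_power M"
  let ?F = "first_order_sums M :: ((nat \<Rightarrow> 'a) \<Rightarrow> 'k) set"
  interpret P: prob_space ?P by (rule prob_space_infinite_power) (rule prob_space_axioms)
  have "U2_1 M \<subseteq> Lp_closure ?P 1 ?F"
  proof
    fix u :: "(nat \<Rightarrow> 'a) \<Rightarrow> 'k" assume "u \<in> U2_1 M"
    then have u: "u \<in> Lp_closure ?P 2 ?F" using U2_1_subset_closure by blast
    then have uL: "u \<in> Lp ?P 2" by (simp add: closure_in_def)
    have "\<exists>F\<in>?F. Lp_norm ?P 1 (u - F) < e" if e: "0 < e" for e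
    proof -
      obtain F where F: "F \<in> ?F" "Lp_norm ?P 2 (u - F) < e" by (rule Lp_closureE[OF u e])
      have "F \<in> Lp ?P 2" using F first_order_sums_subset_Lp2 by blast
      with uL have "u - F \<in> Lp ?P 2" by (rule Lp_diff(1)) simp
      then show ?thesis using P.Lp_2_into_Lp_1(2)[of "u - F"] F by (intro bexI[of _ F]) auto
    qed
    then show "u \<in> Lp_closure ?P 1 ?F" using P.Lp_2_into_Lp_1(1)[OF uL] by (auto simp: closure_in_def)
  qed
  then show "U1_1 M \<subseteq> Lp_closure ?P 1 ?F"
    unfolding U1_1_def by (intro Lp_closure_minimal first_order_sums_subset_Lp1) auto
  show "Lp_closure ?P 1 ?F \<subseteq> U1_1 M"
    unfolding U1_1_def using first_order_sums_subset_U2_1 by (auto simp: closure_in_def) blast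
qed

end

section \<open>Simple sections are dense in the vector-valued spaces\<close>

text \<open>
  Functions on the product that are described by their sections in the first variable: the
  section is a simple function of \<open>x\<close>, with values in a space of functions that carries no measurable
  structure.
\<close>

definition simple_sections ::
  "'a measure \<Rightarrow> 'b measure \<Rightarrow> ((nat \<Rightarrow> 'a) \<times> 'b \<Rightarrow> 'k::euclidean_space) set" where
  "simple_sections M N = {(\<lambda>(\<omega>, x). \<Phi> x \<omega>) | \<Phi>.
     simple_function N \<Phi> \<and> range \<Phi> \<subseteq> first_order_sums M \<and> emeasure N {x \<in> space N. \<Phi> x \<noteq> 0} < \<infinity>}"

lemma simple_sectionsE:
  assumes "z \<in> simple_sections M N"
  obtains \<Phi> where "z = (\<lambda>(\<omega>, x). \<Phi> x \<omega>)" "simple_function N \<Phi>"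
    "range \<Phi> \<subseteq> first_order_sums M" "emeasure N {x \<in> space N. \<Phi> x \<noteq> 0} < \<infinity>"
  using assms unfolding simple_sections_def by blast

text \<open>
  The support condition is stated for an auxiliary \<open>\<Psi>\<close> because \<open>\<Phi>\<close> typically arises from such a \<open>\<Psi>\<close>
  by applying an operation that maps 0 to 0.
\<close>

lemma simple_sectionsI:
  assumes "simple_function N \<Phi>" "\<And>x. \<Phi> x \<in> first_order_sums M"
    and \<Psi>: "simple_function N \<Psi>" "emeasure N {x \<in> space N. \<Psi> x \<noteq> 0} < \<infinity>"
    and "\<And>x. \<Psi> x = 0 \<Longrightarrow> \<Phi> x = 0"
  shows "(\<lambda>(\<omega>, x). \<Phi> x \<omega>) \<in> simple_sections M N"
proof -
  have "{x \<in> space N. \<Psi> x \<noteq> 0} = \<Psi> -` (- {0}) \<inter> space N" by auto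
  then have "{x \<in> space N. \<Psi> x \<noteq> 0} \<in> sets N" using simple_functionD(2)[OF \<Psi>(1)] by metis
  then have "emeasure N {x \<in> space N. \<Phi> x \<noteq> 0} \<le> emeasure N {x \<in> space N. \<Psi> x \<noteq> 0}"
    using assms(5) by (intro emeasure_mono) auto
  then show ?thesis using assms unfolding simple_sections_def by (auto intro: le_less_trans)
qed

lemma (in prob_space) subspace_simple_sections:
  "fun_space.subspace (simple_sections M N :: ((nat \<Rightarrow> 'a) \<times> 'b \<Rightarrow> 'k::{real_normed_field, euclidean_space}) set)"
proof (rule fun_space.subspaceI)
  note sub = subspace_first_order_sums[where 'k = 'k]
  show "(0 :: (nat \<Rightarrow> 'a) \<times> 'b \<Rightarrow> 'k) \<in> simple_sections M N"
    unfolding simple_sections_def using fun_space.subspace_0[OF sub]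
    by (auto intro!: exI[of _ "\<lambda>_. 0"])
next
  note sub = subspace_first_order_sums[where 'k = 'k]
  fix z z' :: "(nat \<Rightarrow> 'a) \<times> 'b \<Rightarrow> 'k"
  assume z: "z \<in> simple_sections M N" "z' \<in> simple_sections M N"
  obtain \<Phi> where \<Phi>: "z = (\<lambda>(\<omega>, x). \<Phi> x \<omega>)" "simple_function N \<Phi>"
    "range \<Phi> \<subseteq> first_order_sums M" "emeasure N {x \<in> space N. \<Phi> x \<noteq> 0} < \<infinity>"
    by (rule simple_sectionsE[OF z(1)])
  obtain \<Psi> where \<Psi>: "z' = (\<lambda>(\<omega>, x). \<Psi> x \<omega>)" "simple_function N \<Psi>"
    "range \<Psi> \<subseteq> first_order_sums M" "emeasure N {x \<in> space N. \<Psi> x \<noteq> 0} < \<infinity>"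
    by (rule simple_sectionsE[OF z(2)])
  have sf: "simple_function N (\<lambda>x. (\<Phi> x, \<Psi> x))"
    by (rule simple_function_compose2[OF \<Phi>(2) \<Psi>(2)])
  have set: "{x \<in> space N. \<Phi> x \<noteq> 0} = \<Phi> -` (- {0}) \<inter> space N" "{x \<in> space N. \<Psi> x \<noteq> 0} = \<Psi> -` (- {0}) \<inter> space N"
    by auto
  have "emeasure N {x \<in> space N. \<Phi> x + \<Psi> x \<noteq> 0} \<le> emeasure N ({x \<in> space N. \<Phi> x \<noteq> 0} \<union> {x \<in> space N. \<Psi> x \<noteq> 0})"
    unfolding set using simple_functionD(2)[OF \<Phi>(2)] simple_functionD(2)[OF \<Psi>(2)]
    by (intro emeasure_mono) auto
  also have "\<dots> \<le> emeasure N {x \<in> space N. \<Phi> x \<noteq> 0} + emeasure N {x \<in> space N. \<Psi> x \<noteq> 0}"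
    unfolding set by (intro emeasure_subadditive simple_functionD(2) \<Phi>(2) \<Psi>(2))
  also have "\<dots> < \<infinity>" using \<Phi>(4) \<Psi>(4) by simp
  finally have "emeasure N {x \<in> space N. \<Phi> x + \<Psi> x \<noteq> 0} < \<infinity>" .
  moreover have "simple_function N (\<lambda>x. \<Phi> x + \<Psi> x)"
    by (rule simple_function_compose2[OF \<Phi>(2) \<Psi>(2)])
  moreover have "z + z' = (\<lambda>(\<omega>, x). (\<Phi> x + \<Psi> x) \<omega>)"
    by (simp add: \<Phi> \<Psi> fun_eq_iff)
  moreover have "range (\<lambda>x. \<Phi> x + \<Psi> x) \<subseteq> first_order_sums M"
    using \<Phi>(3) \<Psi>(3) by (auto intro!: fun_space.subspace_add[OF sub])
  ultimately show "z + z' \<in> simple_sections M N"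
    unfolding simple_sections_def by (intro CollectI exI[of _ "\<lambda>x. \<Phi> x + \<Psi> x"] conjI)
next
  note sub = subspace_first_order_sums[where 'k = 'k]
  fix c and z :: "(nat \<Rightarrow> 'a) \<times> 'b \<Rightarrow> 'k"
  assume z: "z \<in> simple_sections M N"
  obtain \<Phi> where \<Phi>: "z = (\<lambda>(\<omega>, x). \<Phi> x \<omega>)" "simple_function N \<Phi>"
    "range \<Phi> \<subseteq> first_order_sums M" "emeasure N {x \<in> space N. \<Phi> x \<noteq> 0} < \<infinity>"
    by (rule simple_sectionsE[OF z])
  have "(\<lambda>(\<omega>, x). (\<lambda>\<omega>. c * \<Phi> x \<omega>) \<omega>) \<in> simple_sections M N"
  proof (rule simple_sectionsI[where \<Psi> = \<Phi>])
    show "simple_function N (\<lambda>x \<omega>. c * \<Phi> x \<omega>)"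
      by (rule simple_function_compose1[OF \<Phi>(2), where g = "\<lambda>F \<omega>. c * F \<omega>"])
    show "(\<lambda>\<omega>. c * \<Phi> x \<omega>) \<in> first_order_sums M" for x
      using \<Phi>(3) by (intro fun_space.subspace_scale[OF sub]) auto
    show "(\<lambda>\<omega>. c * \<Phi> x \<omega>) = 0" if "\<Phi> x = 0" for x
      using that by (simp add: zero_fun_def)
  qed (use \<Phi> in auto)
  then show "(\<lambda>y. c * z y) \<in> simple_sections M N"
    by (simp add: \<Phi>(1) split_beta')
qed

lemma pair_tensor_Lp:
  fixes u :: "'a \<Rightarrow> 'k::{real_normed_field, euclidean_space}" and b :: "'b \<Rightarrow> 'k"
  assumes "sigma_finite_measure P" "sigma_finite_measure N" and p: "0 < p"
    and u: "u \<in> Lp P p" and b: "b \<in> Lp N p"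
  shows "(\<lambda>(\<omega>, x). u \<omega> * b x) \<in> Lp (P \<Otimes>\<^sub>M N) p"
    and "Lp_norm (P \<Otimes>\<^sub>M N) p (\<lambda>(\<omega>, x). u \<omega> * b x) = Lp_norm P p u * Lp_norm N p b"
proof -
  interpret pair_sigma_finite P N using assms by (simp add: pair_sigma_finite_def)
  have [measurable]: "u \<in> borel_measurable P" "b \<in> borel_measurable N"
    and ui: "integrable P (\<lambda>x. norm (u x) powr p)" and bi: "integrable N (\<lambda>x. norm (b x) powr p)"
    using u b by (auto simp: Lp_def)
  have eq: "norm (case z of (\<omega>, x) \<Rightarrow> u \<omega> * b x) powr p = (case z of (\<omega>, x) \<Rightarrow> norm (u \<omega>) powr p * norm (b x) powr p)" for z
    by (simp add: split_beta norm_mult powr_mult)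
  have int: "integrable (P \<Otimes>\<^sub>M N) (\<lambda>(\<omega>, x). norm (u \<omega>) powr p * norm (b x) powr p)"
    by (rule Fubini_integrable) (use ui bi in auto)
  then show "(\<lambda>(\<omega>, x). u \<omega> * b x) \<in> Lp (P \<Otimes>\<^sub>M N) p"
    unfolding Lp_def eq[symmetric] by simp
  have "(\<integral>z. norm (case z of (\<omega>, x) \<Rightarrow> u \<omega> * b x) powr p \<partial>(P \<Otimes>\<^sub>M N))
      = (\<integral>\<omega>. norm (u \<omega>) powr p \<partial>P) * (\<integral>x. norm (b x) powr p \<partial>N)"
    unfolding eq by (subst integral_fst'[OF int, symmetric]) simp
  then show "Lp_norm (P \<Otimes>\<^sub>M N) p (\<lambda>(\<omega>, x). u \<omega> * b x) = Lp_norm P p u * Lp_norm N p b"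
    unfolding Lp_norm_def by (simp add: powr_mult Bochner_Integration.integral_nonneg)
qed

lemma tensor_subset_Lp:
  fixes U :: "('a \<Rightarrow> 'k::{real_normed_field, euclidean_space}) set" and N :: "'b measure"
  assumes "sigma_finite_measure P" "sigma_finite_measure N" and p: "1 \<le> p" and U: "U \<subseteq> Lp P p"
  shows "tensor U (Lp N p) \<subseteq> Lp (P \<Otimes>\<^sub>M N) p"
  unfolding tensor_def
proof (rule fun_space.span_minimal)
  show "{\<lambda>(\<omega>, x). u \<omega> * b x |u b. u \<in> U \<and> b \<in> Lp N p} \<subseteq> Lp (P \<Otimes>\<^sub>M N) p"
    using U p by (auto intro!: pair_tensor_Lp(1)[OF assms(1,2)])
qed (rule Lp_subspace[OF p])

text \<open>
  A function with simple sections is the finite sum, over the nonzero sections \<open>F\<close>, of \<open>F\<close> tensored with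
  the indicator of the set where \<open>F\<close> occurs.
\<close>

lemma simple_sections_subset_tensor:
  fixes U :: "((nat \<Rightarrow> 'a) \<Rightarrow> 'k::{real_normed_field, euclidean_space}) set" and N :: "'b measure"
  assumes N: "space N = UNIV" and U: "first_order_sums M \<subseteq> U" and p: "0 < p"
  shows "simple_sections M N \<subseteq> tensor U (Lp N p)"
proof
  fix z :: "(nat \<Rightarrow> 'a) \<times> 'b \<Rightarrow> 'k" assume z: "z \<in> simple_sections M N"
  obtain \<Phi> where \<Phi>: "z = (\<lambda>(\<omega>, x). \<Phi> x \<omega>)" "simple_function N \<Phi>"
    "range \<Phi> \<subseteq> first_order_sums M" "emeasure N {x \<in> space N. \<Phi> x \<noteq> 0} < \<infinity>"
    by (rule simple_sectionsE[OF z])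
  let ?b = "\<lambda>F x. indicator (\<Phi> -` {F}) x :: 'k"
  have fin: "finite (range \<Phi>)" using simple_functionD(1)[OF \<Phi>(2)] N by simp
  have b: "?b F \<in> Lp N p" if "F \<noteq> 0" for F
  proof -
    have F_sets: "\<Phi> -` X \<in> sets N" for X using simple_functionD(2)[OF \<Phi>(2), of X] N by simp
    have "emeasure N (\<Phi> -` {F}) \<le> emeasure N (\<Phi> -` (- {0}))"
      using that by (intro emeasure_mono F_sets) auto
    also have "\<Phi> -` (- {0}) = {x \<in> space N. \<Phi> x \<noteq> 0}" using N by auto
    finally have "emeasure N (\<Phi> -` {F}) < \<infinity>" using \<Phi>(4) by (rule le_less_trans)
    then have "integrable N (indicator (\<Phi> -` {F}) :: 'b \<Rightarrow> real)"
      using F_sets by (intro integrable_real_indicator) auto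
    moreover have "norm (?b F x) powr p = indicator (\<Phi> -` {F}) x" for x
      using p by (simp add: indicator_def)
    ultimately show ?thesis using F_sets[of "{F}"] by (simp add: Lp_def)
  qed
  have "z = (\<Sum>F\<in>range \<Phi> - {0}. (\<lambda>(\<omega>, x). F \<omega> * ?b F x))"
  proof
    fix y :: "(nat \<Rightarrow> 'a) \<times> 'b"
    obtain \<omega> x where y: "y = (\<omega>, x)" by (cases y)
    have "(\<Sum>F\<in>range \<Phi> - {0}. F \<omega> * ?b F x) = (\<Sum>F\<in>range \<Phi>. if F = \<Phi> x then F \<omega> else 0)"
      using fin by (intro sum.mono_neutral_cong_left) (auto simp: indicator_def)
    also have "\<dots> = \<Phi> x \<omega>" using fin by (simp add: sum.delta)
    finally show "z y = (\<Sum>F\<in>range \<Phi> - {0}. (\<lambda>(\<omega>, x). F \<omega> * ?b F x)) y"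
      by (simp add: y \<Phi>(1) sum_fun_apply)
  qed
  also have "\<dots> \<in> tensor U (Lp N p)"
    unfolding tensor_def
  proof (intro fun_space.span_sum fun_space.span_base)
    fix F assume "F \<in> range \<Phi> - {0}"
    then show "(\<lambda>(\<omega>, x). F \<omega> * ?b F x) \<in> {\<lambda>(\<omega>, x). u \<omega> * b x |u b. u \<in> U \<and> b \<in> Lp N p}"
      using \<Phi>(3) U b[of F] by blast
  qed
  finally show "z \<in> tensor U (Lp N p)" .
qed

text \<open>
  Pointwise approximation by simple functions dominated by \<open>2 |b|\<close>, cut off along an exhaustion by
  sets of finite measure in order to obtain supports of finite measure.
\<close>

lemma Lp_simple_approx:
  fixes b :: "'b \<Rightarrow> 'k::{banach, second_countable_topology}"
  assumes "sigma_finite_measure N" and p: "0 < p" and b: "b \<in> Lp N p" and e: "0 < e"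
  obtains s where "simple_function N s" "emeasure N {x \<in> space N. s x \<noteq> 0} < \<infinity>"
    "s \<in> Lp N p" "Lp_norm N p (\<lambda>x. b x - s x) < e"
proof -
  interpret sigma_finite_measure N by fact
  have bm[measurable]: "b \<in> borel_measurable N" and bi: "integrable N (\<lambda>x. norm (b x) powr p)"
    using b by (auto simp: Lp_def)
  obtain F where F: "\<And>i. simple_function N (F i)" "\<And>x. x \<in> space N \<Longrightarrow> (\<lambda>i. F i x) \<longlonglongrightarrow> b x"
    "\<And>i x. x \<in> space N \<Longrightarrow> dist (F i x) 0 \<le> 2 * dist (b x) 0"
    using borel_measurable_implies_sequence_metric[OF bm, of 0] by blast
  obtain A :: "nat \<Rightarrow> 'b set" where A: "range A \<subseteq> sets N" "(\<Union>i. A i) = space N"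
    "\<And>i. emeasure N (A i) \<noteq> \<infinity>" "incseq A"
    using sigma_finite_incseq by blast
  have A_sets[measurable]: "A i \<in> sets N" for i using A(1) by auto
  define s where "s i x = indicator (A i) x *\<^sub>R F i x" for i x
  have s_simple: "simple_function N (s i)" for i
    unfolding s_def[abs_def]
    by (rule simple_function_compose2[OF simple_function_indicator[OF A_sets] F(1)])
  have s_meas[measurable]: "s i \<in> borel_measurable N" for i
    by (rule borel_measurable_simple_function[OF s_simple])
  have s_bound: "norm (s i x) \<le> 2 * norm (b x)" if "x \<in> space N" for i x
    using F(3)[OF that, of i] by (simp add: s_def indicator_def)
  have s_lim: "(\<lambda>i. s i x) \<longlonglongrightarrow> b x" if x: "x \<in> space N" for x
  proof -
    obtain j where "x \<in> A j" using A(2) x by blast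
    then have "F i x = s i x" if "j \<le> i" for i
      using subsetD[OF incseqD[OF A(4) that]] by (simp add: s_def)
    then have "eventually (\<lambda>i. F i x = s i x) sequentially"
      by (rule eventually_sequentiallyI)
    then show ?thesis using F(2)[OF x] by (rule Lim_transform_eventually[rotated])
  qed
  have bound: "norm (b x - s i x) powr p \<le> 3 powr p * norm (b x) powr p" if "x \<in> space N" for i x
  proof -
    have "norm (b x - s i x) \<le> 3 * norm (b x)"
      using norm_triangle_ineq4[of "b x" "s i x"] s_bound[OF that, of i] by simp
    then have "norm (b x - s i x) powr p \<le> (3 * norm (b x)) powr p"
      using p by (intro powr_mono2) auto
    then show ?thesis by (simp add: powr_mult)
  qed
  have "(\<lambda>i. \<integral>x. norm (b x - s i x) powr p \<partial>N) \<longlonglongrightarrow> (\<integral>x. 0 \<partial>N)"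
  proof (rule integral_dominated_convergence[where w = "\<lambda>x. 3 powr p * norm (b x) powr p"])
    show "AE x in N. (\<lambda>i. norm (b x - s i x) powr p) \<longlonglongrightarrow> 0"
    proof (rule AE_I2)
      fix x assume "x \<in> space N"
      then have "(\<lambda>i. norm (b x - s i x)) \<longlonglongrightarrow> norm (b x - b x)"
        by (intro tendsto_intros s_lim)
      then show "(\<lambda>i. norm (b x - s i x) powr p) \<longlonglongrightarrow> 0"
        using p by (intro tendsto_zero_powrI[where b = p]) auto
    qed
  qed (use bi bound in auto)
  then have "(\<lambda>i. Lp_norm N p (\<lambda>x. b x - s i x)) \<longlonglongrightarrow> 0"
    unfolding Lp_norm_def using p
    by (intro tendsto_zero_powrI[where b = "1 / p"]) (auto simp: Bochner_Integration.integral_nonneg)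
  then have "eventually (\<lambda>i. Lp_norm N p (\<lambda>x. b x - s i x) < e) sequentially"
    using e by (rule order_tendstoD(2))
  then obtain i where i: "Lp_norm N p (\<lambda>x. b x - s i x) < e"
    by (auto simp: eventually_sequentially)
  have "emeasure N {x \<in> space N. s i x \<noteq> 0} \<le> emeasure N (A i)"
    by (intro emeasure_mono) (auto simp: s_def indicator_def)
  then have "emeasure N {x \<in> space N. s i x \<noteq> 0} < \<infinity>"
    using A(3)[of i] by (simp add: top.not_eq_extremum le_less_trans)
  moreover have "s i \<in> Lp N p"
  proof -
    have "norm (s i x) powr p \<le> 2 powr p * norm (b x) powr p" if "x \<in> space N" for x
      using powr_mono2[OF less_imp_le[OF p] _ s_bound[OF that, of i]] by (simp add: powr_mult)
    then have "integrable N (\<lambda>x. norm (s i x) powr p)"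
      by (intro Bochner_Integration.integrable_bound[OF integrable_mult_right[OF bi, of "2 powr p"]]) auto
    then show ?thesis by (simp add: Lp_def)
  qed
  ultimately show thesis using that s_simple i by blast
qed

text \<open>
  Each factor of an elementary tensor is approximated separately, through
  \<open>u \<otimes> b - v \<otimes> s = (u - v) \<otimes> b + v \<otimes> (b - s)\<close>.
\<close>

lemma (in prob_space) tensor_subset_closure_simple_sections:
  fixes U :: "((nat \<Rightarrow> 'a) \<Rightarrow> 'k::{real_normed_field, euclidean_space}) set" and N :: "'b measure"
  assumes N: "sigma_finite_measure N" "space N = UNIV" and p: "1 \<le> p"
    and F: "(first_order_sums M :: ((nat \<Rightarrow> 'a) \<Rightarrow> 'k) set) \<subseteq> Lp (infinite_power M) p"
    and U: "U \<subseteq> Lp_closure (infinite_power M) p (first_order_sums M)"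
  shows "tensor U (Lp N p) \<subseteq> Lp_closure (infinite_power M \<Otimes>\<^sub>M N) p (simple_sections M N)"
  unfolding tensor_def
proof (rule fun_space.span_minimal)
  let ?P = "infinite_power M"
  interpret P: prob_space ?P by (rule prob_space_infinite_power) (rule prob_space_axioms)
  note sf = P.sigma_finite_measure_axioms N(1)
  have p0: "0 < p" using p by simp
  have Z: "simple_sections M N \<subseteq> (Lp (?P \<Otimes>\<^sub>M N) p :: ((nat \<Rightarrow> 'a) \<times> 'b \<Rightarrow> 'k) set)"
    using simple_sections_subset_tensor[OF N(2) subset_refl p0] tensor_subset_Lp[OF sf p F] by blast
  then show "fun_space.subspace (Lp_closure (?P \<Otimes>\<^sub>M N) p (simple_sections M N :: ((nat \<Rightarrow> 'a) \<times> 'b \<Rightarrow> 'k) set))"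
    by (intro subspace_Lp_closure subspace_simple_sections p)
  show "{\<lambda>(\<omega>, x). u \<omega> * b x |u b. u \<in> U \<and> b \<in> Lp N p} \<subseteq> Lp_closure (?P \<Otimes>\<^sub>M N) p (simple_sections M N)"
  proof safe
    fix u :: "(nat \<Rightarrow> 'a) \<Rightarrow> 'k" and b :: "'b \<Rightarrow> 'k"
    assume u: "u \<in> U" and b: "b \<in> Lp N p"
    have uF: "u \<in> Lp_closure ?P p (first_order_sums M)" using U u by blast
    then have uL: "u \<in> Lp ?P p" by (simp add: closure_in_def)
    have "\<exists>z\<in>simple_sections M N. Lp_norm (?P \<Otimes>\<^sub>M N) p ((\<lambda>(\<omega>, x). u \<omega> * b x) - z) < e" if e: "0 < e" for e
    proof -
      have "0 < e / 8 / (Lp_norm N p b + 1)"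
        using e by (simp add: Lp_norm_nonneg add_nonneg_pos)
      then obtain v where v: "v \<in> first_order_sums M" "Lp_norm ?P p (u - v) < e / 8 / (Lp_norm N p b + 1)"
        by (rule Lp_closureE[OF uF])
      have "0 < e / 8 / (Lp_norm ?P p v + 1)"
        using e by (simp add: Lp_norm_nonneg add_nonneg_pos)
      then obtain s where s: "simple_function N s" "emeasure N {x \<in> space N. s x \<noteq> 0} < \<infinity>"
        "s \<in> Lp N p" "Lp_norm N p (\<lambda>x. b x - s x) < e / 8 / (Lp_norm ?P p v + 1)"
        by (rule Lp_simple_approx[OF N(1) p0 b])
      have vL: "v \<in> Lp ?P p" using v F by blast
      have uv: "u - v \<in> Lp ?P p" by (rule Lp_diff(1)[OF uL vL p])
      have bs: "(\<lambda>x. b x - s x) \<in> Lp N p" using Lp_diff(1)[OF b s(3) p] by (simp add: fun_diff_def)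
      have "(\<lambda>(\<omega>, x). (\<lambda>\<omega>. s x * v \<omega>) \<omega>) \<in> simple_sections M N"
        by (rule simple_sectionsI[where \<Psi> = s, OF simple_function_compose1[OF s(1)]])
          (use s v in \<open>auto simp: zero_fun_def intro!: fun_space.subspace_scale[OF subspace_first_order_sums]\<close>)
      then have z: "(\<lambda>(\<omega>, x). v \<omega> * s x) \<in> simple_sections M N" by (simp add: mult.commute)
      note t1 = pair_tensor_Lp[OF sf p0 uv b] and t2 = pair_tensor_Lp[OF sf p0 vL bs]
      have eq: "(\<lambda>(\<omega>, x). u \<omega> * b x) - (\<lambda>(\<omega>, x). v \<omega> * s x)
          = (\<lambda>(\<omega>, x). (u - v) \<omega> * b x) + (\<lambda>(\<omega>, x). v \<omega> * (b x - s x))"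
        by (simp add: fun_eq_iff algebra_simps)
      have small: "x * y < d" if "x < d / (y + 1)" "0 \<le> x" "0 \<le> y" for x y d :: real
      proof -
        have "x * (y + 1) < d" using that pos_less_divide_eq[of "y + 1" x d] by simp
        then show ?thesis using that by (simp add: distrib_left)
      qed
      have "Lp_norm (?P \<Otimes>\<^sub>M N) p ((\<lambda>(\<omega>, x). u \<omega> * b x) - (\<lambda>(\<omega>, x). v \<omega> * s x))
          \<le> 4 * (Lp_norm ?P p (u - v) * Lp_norm N p b + Lp_norm N p (\<lambda>x. b x - s x) * Lp_norm ?P p v)"
        unfolding eq using Lp_add(2)[OF t1(1) t2(1) p] t1(2) t2(2) by (simp add: mult.commute)
      also have "\<dots> < 4 * (e / 8 + e / 8)"
        by (intro mult_strict_left_mono add_strict_mono small v(2) s(4) Lp_norm_nonneg) simp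
      also have "\<dots> = e" by simp
      finally show ?thesis using z by blast
    qed
    then show "(\<lambda>(\<omega>, x). u \<omega> * b x) \<in> Lp_closure (?P \<Otimes>\<^sub>M N) p (simple_sections M N)"
      using pair_tensor_Lp(1)[OF sf p0 uL b] by (auto simp: closure_in_def)
  qed
qed

section \<open>Integrating the scalar decomposition\<close>

text \<open>
  The scalar decomposition is applied at each \<open>x\<close> with the same \<open>r\<close>. As it depends
  only on the section, \<open>A\<close> and \<open>B\<close> again have simple sections. For almost every \<open>x\<close> the sections of \<open>g\<close> and
  \<open>h\<close> form an admissible competitor, and integrating the scalar inequality over \<open>x\<close> gives the claim.
\<close>

lemma (in prob_space) simple_sections_decomposition:
  fixes F :: "(nat \<Rightarrow> 'a) \<times> 'b \<Rightarrow> 'k::{real_normed_field, euclidean_space}"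
  assumes N: "sigma_finite_measure N" "space N = UNIV"
    and F: "F \<in> simple_sections M N" and r: "0 < r"
  obtains A B where "A \<in> simple_sections M N" "B \<in> simple_sections M N" "F = A + B"
    and "\<And>g h. g \<in> Lp (infinite_power M \<Otimes>\<^sub>M N) 1 \<Longrightarrow> h \<in> Lp (infinite_power M \<Otimes>\<^sub>M N) 2 \<Longrightarrow> F = g + h \<Longrightarrow>
      Lp_norm (infinite_power M \<Otimes>\<^sub>M N) 1 A + (Lp_norm (infinite_power M \<Otimes>\<^sub>M N) 2 B)\<^sup>2 / r
      \<le> 32 * (Lp_norm (infinite_power M \<Otimes>\<^sub>M N) 1 g + (Lp_norm (infinite_power M \<Otimes>\<^sub>M N) 2 h)\<^sup>2 / r)"
proof -
  let ?P = "infinite_power M"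
  interpret P: prob_space ?P by (rule prob_space_infinite_power) (rule prob_space_axioms)
  note sf = P.sigma_finite_measure_axioms N(1)
  interpret N: sigma_finite_measure N by fact
  interpret pair_sigma_finite ?P N ..
  obtain \<Phi> where \<Phi>: "F = (\<lambda>(\<omega>, x). \<Phi> x \<omega>)" "simple_function N \<Phi>"
    "range \<Phi> \<subseteq> first_order_sums M" "emeasure N {x \<in> space N. \<Phi> x \<noteq> 0} < \<infinity>"
    by (rule simple_sectionsE[OF F])
  define good where "good f a b \<longleftrightarrow> a \<in> first_order_sums M \<and> b \<in> first_order_sums M \<and> f = a + b \<and>
    (\<forall>g h. integrable ?P g \<longrightarrow> h \<in> borel_measurable ?P \<longrightarrow> integrable ?P (\<lambda>\<omega>. (norm (h \<omega>))\<^sup>2) \<longrightarrow>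
      (\<forall>\<omega>\<in>space ?P. f \<omega> = g \<omega> + h \<omega>) \<longrightarrow>
      (\<integral>\<omega>. norm (a \<omega>) \<partial>?P) + (\<integral>\<omega>. (norm (b \<omega>))\<^sup>2 \<partial>?P) / r
      \<le> 32 * ((\<integral>\<omega>. norm (g \<omega>) \<partial>?P) + (\<integral>\<omega>. (norm (h \<omega>))\<^sup>2 \<partial>?P) / r))"
    for f a b :: "(nat \<Rightarrow> 'a) \<Rightarrow> 'k"
  \<comment> \<open>The zero section has to be decomposed trivially, in order to keep supports of finite measure.\<close>
  have "\<exists>ab. good f (fst ab) (snd ab) \<and> (f = 0 \<longrightarrow> ab = (0, 0))" if f: "f \<in> first_order_sums M" for f
  proof (cases "f = 0")
    case True
    have "good 0 0 0"
      unfolding good_def using f True r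
      by (auto intro!: add_nonneg_nonneg divide_nonneg_pos Bochner_Integration.integral_nonneg)
    then show ?thesis using True by (intro exI[of _ "(0, 0)"]) simp
  next
    case False
    obtain a b where "good f a b"
      using first_order_decomposition[OF f r] unfolding good_def by (auto simp: fun_eq_iff)
    then show ?thesis using False by (intro exI[of _ "(a, b)"]) simp
  qed
  then obtain ab where ab: "\<And>f. f \<in> first_order_sums M \<Longrightarrow> good f (fst (ab f)) (snd (ab f))"
    "\<And>f. f \<in> first_order_sums M \<Longrightarrow> f = 0 \<Longrightarrow> ab f = (0, 0)" by metis
  have \<Phi>F: "\<Phi> x \<in> first_order_sums M" for x using \<Phi>(3) by blast
  note good = ab(1)[OF \<Phi>F, unfolded good_def]
  define A where "A = (\<lambda>(\<omega>, x). fst (ab (\<Phi> x)) \<omega>)"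
  define B where "B = (\<lambda>(\<omega>, x). snd (ab (\<Phi> x)) \<omega>)"
  have A: "A \<in> simple_sections M N"
    unfolding A_def
    by (rule simple_sectionsI[where \<Psi> = \<Phi>, OF simple_function_compose1[OF \<Phi>(2), where g = "\<lambda>f. fst (ab f)"]])
      (use \<Phi> good ab(2)[OF \<Phi>F] in simp_all)
  have B: "B \<in> simple_sections M N"
    unfolding B_def
    by (rule simple_sectionsI[where \<Psi> = \<Phi>, OF simple_function_compose1[OF \<Phi>(2), where g = "\<lambda>f. snd (ab f)"]])
      (use \<Phi> good ab(2)[OF \<Phi>F] in simp_all)
  have "\<Phi> x = fst (ab (\<Phi> x)) + snd (ab (\<Phi> x))" for x using good[of x] by blast
  then have F_eq: "F = A + B"
    unfolding A_def B_def \<Phi>(1) by (auto simp: fun_eq_iff)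
  have ZL: "simple_sections M N \<subseteq> (Lp (?P \<Otimes>\<^sub>M N) p :: ((nat \<Rightarrow> 'a) \<times> 'b \<Rightarrow> 'k) set)"
    if "1 \<le> p" "(first_order_sums M :: ((nat \<Rightarrow> 'a) \<Rightarrow> 'k) set) \<subseteq> Lp ?P p" for p
    using simple_sections_subset_tensor[OF N(2) subset_refl, of p M] that
      tensor_subset_Lp[OF sf that] by (meson less_le_trans order_trans zero_less_one)
  have A1: "integrable (?P \<Otimes>\<^sub>M N) A"
    using A ZL[OF _ first_order_sums_subset_Lp1] by (auto simp: Lp_1_iff)
  have B2: "integrable (?P \<Otimes>\<^sub>M N) (\<lambda>z. (norm (B z))\<^sup>2)"
    using B ZL[OF _ first_order_sums_subset_Lp2] by (auto simp: Lp_2_iff)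
  have "Lp_norm (?P \<Otimes>\<^sub>M N) 1 A + (Lp_norm (?P \<Otimes>\<^sub>M N) 2 B)\<^sup>2 / r
      \<le> 32 * (Lp_norm (?P \<Otimes>\<^sub>M N) 1 g + (Lp_norm (?P \<Otimes>\<^sub>M N) 2 h)\<^sup>2 / r)"
    if g: "g \<in> Lp (?P \<Otimes>\<^sub>M N) 1" and h: "h \<in> Lp (?P \<Otimes>\<^sub>M N) 2" and eq: "F = g + h" for g h
  proof -
    have g1: "integrable (?P \<Otimes>\<^sub>M N) g" using g by (simp add: Lp_1_iff)
    have hm[measurable]: "h \<in> borel_measurable (?P \<Otimes>\<^sub>M N)"
      and h2: "integrable (?P \<Otimes>\<^sub>M N) (\<lambda>z. (norm (h z))\<^sup>2)"
      using h by (auto simp: Lp_2_iff)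
    let ?l = "\<lambda>z. norm (A z) + (norm (B z))\<^sup>2 / r" and ?u = "\<lambda>z. 32 * (norm (g z) + (norm (h z))\<^sup>2 / r)"
    have l_int: "integrable (?P \<Otimes>\<^sub>M N) (case_prod (\<lambda>\<omega> x. ?l (\<omega>, x)))"
      and u_int: "integrable (?P \<Otimes>\<^sub>M N) (case_prod (\<lambda>\<omega> x. ?u (\<omega>, x)))"
      using A1 B2 g1 h2 by (simp_all add: split_beta')
    have g_sec: "AE x in N. integrable ?P (\<lambda>\<omega>. g (\<omega>, x))"
      by (rule AE_integrable_snd) (use g1 in \<open>simp add: split_beta'\<close>)
    have h_sec: "AE x in N. integrable ?P (\<lambda>\<omega>. (norm (h (\<omega>, x)))\<^sup>2)"
      by (rule AE_integrable_snd) (use h2 in \<open>simp add: split_beta'\<close>)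
    have sections: "AE x in N. (\<integral>\<omega>. ?l (\<omega>, x) \<partial>?P) \<le> (\<integral>\<omega>. ?u (\<omega>, x) \<partial>?P)"
      using g_sec h_sec AE_space
    proof eventually_elim
      case (elim x)
      have AB_x: "fst (ab (\<Phi> x)) \<in> first_order_sums M" "snd (ab (\<Phi> x)) \<in> first_order_sums M"
        using good[of x] by blast+
      have "(\<lambda>\<omega>. h (\<omega>, x)) \<in> borel_measurable ?P" using elim(3) by measurable
      moreover have "\<Phi> x \<omega> = g (\<omega>, x) + h (\<omega>, x)" for \<omega>
        using fun_cong[OF eq, of "(\<omega>, x)"] by (simp add: \<Phi>(1))
      ultimately have "(\<integral>\<omega>. norm (A (\<omega>, x)) \<partial>?P) + (\<integral>\<omega>. (norm (B (\<omega>, x)))\<^sup>2 \<partial>?P) / r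
          \<le> 32 * ((\<integral>\<omega>. norm (g (\<omega>, x)) \<partial>?P) + (\<integral>\<omega>. (norm (h (\<omega>, x)))\<^sup>2 \<partial>?P) / r)"
        using good[of x] elim(1,2) unfolding A_def B_def by simp
      moreover have "integrable ?P (\<lambda>\<omega>. norm (A (\<omega>, x)))" "integrable ?P (\<lambda>\<omega>. (norm (B (\<omega>, x)))\<^sup>2)"
        using first_order_sums_square_integrable(3)[OF AB_x(1)] first_order_sums_square_integrable(2)[OF AB_x(2)]
        by (simp_all add: A_def B_def)
      ultimately show ?case using elim(1,2) by simp
    qed
    have "(\<integral>x. (\<integral>\<omega>. ?l (\<omega>, x) \<partial>?P) \<partial>N) \<le> (\<integral>x. (\<integral>\<omega>. ?u (\<omega>, x) \<partial>?P) \<partial>N)"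
      by (rule integral_mono_AE[OF integrable_snd[OF l_int] integrable_snd[OF u_int] sections])
    then have "(\<integral>z. ?l z \<partial>(?P \<Otimes>\<^sub>M N)) \<le> (\<integral>z. ?u z \<partial>(?P \<Otimes>\<^sub>M N))"
      unfolding integral_snd[OF l_int] integral_snd[OF u_int] by (simp add: split_beta')
    then show ?thesis
      using A1 B2 g1 h2 by (simp add: Lp_norm_1 Lp_norm_2 Bochner_Integration.integral_nonneg)
  qed
  then show thesis using that A B F_eq by blast
qed

section \<open>From decompositions to the K-functional\<close>

lemma K_functional_le:
  assumes "f0 \<in> X0" "f1 \<in> X1" "f = f0 + f1" "\<And>f. 0 \<le> n0 f" "\<And>f. 0 \<le> n1 f" "0 < t"
  shows "K_functional X0 n0 X1 n1 f t \<le> n0 f0 + t * n1 f1"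
  unfolding K_functional_def
proof (rule cInf_lower)
  show "bdd_below {n0 f0 + t * n1 f1 |f0 f1. f0 \<in> X0 \<and> f1 \<in> X1 \<and> f = f0 + f1}"
    using assms by (intro bdd_belowI[of _ 0]) auto
qed (use assms in blast)

lemma K_functional_cong:
  assumes "\<And>f. f \<in> X0 \<Longrightarrow> n0 f = n0' f" "\<And>f. f \<in> X1 \<Longrightarrow> n1 f = n1' f"
  shows "K_functional X0 n0 X1 n1 f t = K_functional X0 n0' X1 n1' f t"
  unfolding K_functional_def
  by (intro arg_cong[where f = Inf] Collect_cong iff_exI) (auto simp: assms)

lemma K_closedI:
  assumes sub: "Y0 \<subseteq> X0" "Y1 \<subseteq> X1" and C: "0 < C"
    and K: "\<And>f0 f1 g h t. f0 \<in> Y0 \<Longrightarrow> f1 \<in> Y1 \<Longrightarrow> g \<in> X0 \<Longrightarrow> h \<in> X1 \<Longrightarrow> f0 + f1 = g + h \<Longrightarrow> 0 < t \<Longrightarrow>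
      K_functional Y0 n0 Y1 n1 (f0 + f1) t \<le> C * (n0 g + t * n1 h)"
  shows "K_closed Y0 Y1 X0 n0 X1 n1"
  unfolding K_closed_def
proof (intro exI[of _ C] ballI allI impI)
  fix f0 f1 and t :: real assume f: "f0 \<in> Y0" "f1 \<in> Y1" "0 < t"
  have "K_functional Y0 n0 Y1 n1 (f0 + f1) t / C \<le> K_functional X0 n0 X1 n1 (f0 + f1) t"
    unfolding K_functional_def[of X0]
  proof (rule cInf_greatest)
    show "{n0 g + t * n1 h |g h. g \<in> X0 \<and> h \<in> X1 \<and> f0 + f1 = g + h} \<noteq> {}"
      using f sub by blast
    fix y assume "y \<in> {n0 g + t * n1 h |g h. g \<in> X0 \<and> h \<in> X1 \<and> f0 + f1 = g + h}"
    then show "K_functional Y0 n0 Y1 n1 (f0 + f1) t / C \<le> y"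
      using K f C by (auto simp: divide_le_eq mult.commute)
  qed
  then show "K_functional Y0 n0 Y1 n1 (f0 + f1) t \<le> C * K_functional X0 n0 X1 n1 (f0 + f1) t"
    using C by (simp add: divide_le_eq mult.commute)
qed

text \<open>
  \<open>f0\<close> and \<open>f1\<close> are replaced by elements of \<open>Z\<close>, and the small errors are first absorbed into the competitors
  and then given back to the decomposition obtained, which stays within the closures because these are
  subspaces. The level is \<open>r = \<eta> / t\<close>, where \<open>\<eta>\<close> bounds the \<open>L\<^sup>2\<close> norm of the modified competitor and
  is positive even if \<open>h\<close> vanishes.
\<close>

lemma (in prob_space) K_functional_closure_simple_sections:
  fixes f0 f1 g h :: "(nat \<Rightarrow> 'a) \<times> 'b \<Rightarrow> 'k::{real_normed_field, euclidean_space}"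
    and N :: "'b measure"
  defines "Z \<equiv> simple_sections M N :: ((nat \<Rightarrow> 'a) \<times> 'b \<Rightarrow> 'k) set"
    and "Q \<equiv> infinite_power M \<Otimes>\<^sub>M N"
  assumes N: "sigma_finite_measure N" "space N = UNIV"
    and Z: "Z \<subseteq> Lp Q 1" "Z \<subseteq> Lp Q 2"
    and f: "f0 \<in> Lp_closure Q 1 Z" "f1 \<in> Lp_closure Q 2 Z"
    and gh: "g \<in> Lp Q 1" "h \<in> Lp Q 2" "f0 + f1 = g + h" and t: "0 < t"
  shows "K_functional (Lp_closure Q 1 Z) (Lp_norm Q 1) (Lp_closure Q 2 Z) (Lp_norm Q 2) (f0 + f1) t
    \<le> 1024 * (Lp_norm Q 1 g + t * Lp_norm Q 2 h)"
proof -
  let ?K = "K_functional (Lp_closure Q 1 Z) (Lp_norm Q 1) (Lp_closure Q 2 Z) (Lp_norm Q 2) (f0 + f1) t"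
  have fL: "f0 \<in> Lp Q 1" "f1 \<in> Lp Q 2" using f by (auto simp: closure_in_def)
  have Z_sub: "fun_space.subspace Z" unfolding Z_def by (rule subspace_simple_sections)
  have sub1: "fun_space.subspace (Lp_closure Q 1 Z)" and sub2: "fun_space.subspace (Lp_closure Q 2 Z)"
    using Z Z_sub by (auto intro: subspace_Lp_closure)
  have bound: "?K \<le> 1024 * (Lp_norm Q 1 g + t * Lp_norm Q 2 h) + 1028 * ((1 + t) * e)" if e: "0 < e" for e
  proof -
    obtain F0 where F0: "F0 \<in> Z" "Lp_norm Q 1 (f0 - F0) < e" by (rule Lp_closureE[OF f(1) e])
    obtain F1 where F1: "F1 \<in> Z" "Lp_norm Q 2 (f1 - F1) < e" by (rule Lp_closureE[OF f(2) e])
    have FZ: "F0 + F1 \<in> Z" by (rule fun_space.subspace_add[OF Z_sub F0(1) F1(1)])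
    have d0: "f0 - F0 \<in> Lp Q 1" and d1: "f1 - F1 \<in> Lp Q 2"
      using fL F0 F1 Z by (auto intro!: Lp_diff(1))
    define g' where "g' = g - (f0 - F0)"
    define h' where "h' = h - (f1 - F1)"
    have g': "g' \<in> Lp Q 1" and h': "h' \<in> Lp Q 2"
      unfolding g'_def h'_def using gh d0 d1 by (auto intro!: Lp_diff(1))
    have "F0 + F1 = (f0 + f1) - (f0 - F0) - (f1 - F1)" by (simp add: algebra_simps)
    then have eq: "F0 + F1 = g' + h'" unfolding gh(3) g'_def h'_def by (simp add: algebra_simps)
    define \<gamma> where "\<gamma> = 4 * (Lp_norm Q 1 g + e)"
    define \<eta> where "\<eta> = 4 * (Lp_norm Q 2 h + e)"
    have g'_le: "Lp_norm Q 1 g' \<le> \<gamma>"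
      unfolding g'_def \<gamma>_def using Lp_diff(2)[OF gh(1) d0] F0(2) by simp
    have h'_le: "Lp_norm Q 2 h' \<le> \<eta>"
      unfolding h'_def \<eta>_def using Lp_diff(2)[OF gh(2) d1] F1(2) by simp
    have \<gamma>: "0 \<le> \<gamma>" and \<eta>: "0 < \<eta>"
      unfolding \<gamma>_def \<eta>_def using e by (simp_all add: Lp_norm_nonneg add_nonneg_pos less_imp_le)
    have r: "0 < \<eta> / t" using \<eta> t by simp
    obtain A B where AB: "A \<in> Z" "B \<in> Z" "F0 + F1 = A + B"
      and le: "Lp_norm Q 1 A + (Lp_norm Q 2 B)\<^sup>2 / (\<eta> / t) \<le> 32 * (Lp_norm Q 1 g' + (Lp_norm Q 2 h')\<^sup>2 / (\<eta> / t))"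
      using simple_sections_decomposition[OF N FZ[unfolded Z_def] r, folded Z_def Q_def] g' h' eq by metis
    define \<kappa> where "\<kappa> = \<gamma> + t * \<eta>"
    \<comment> \<open>For this \<open>r\<close> the quadratic functional of the competitor is at most \<open>\<kappa>\<close>, and a bound by \<open>32 \<kappa>\<close> for that of
      \<open>A + B\<close> bounds \<open>t\<close> times the \<open>L\<^sup>2\<close> norm of \<open>B\<close> by the geometric mean of \<open>32 \<kappa>\<close> and \<open>t \<eta> \<le> \<kappa>\<close>.\<close>
    have "(Lp_norm Q 2 h')\<^sup>2 / (\<eta> / t) \<le> \<eta>\<^sup>2 / (\<eta> / t)"
      using r h'_le by (intro divide_right_mono power_mono) (auto simp: Lp_norm_nonneg)
    also have "\<dots> = t * \<eta>" using \<eta> by (simp add: power2_eq_square)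
    finally have "32 * (Lp_norm Q 1 g' + (Lp_norm Q 2 h')\<^sup>2 / (\<eta> / t)) \<le> 32 * \<kappa>"
      unfolding \<kappa>_def using g'_le by (intro mult_left_mono add_mono) auto
    with le have le: "Lp_norm Q 1 A + (Lp_norm Q 2 B)\<^sup>2 / (\<eta> / t) \<le> 32 * \<kappa>" by (rule order_trans)
    have "0 \<le> (Lp_norm Q 2 B)\<^sup>2 / (\<eta> / t)"
      using r by (intro divide_nonneg_pos) auto
    then have A_le: "Lp_norm Q 1 A \<le> 32 * \<kappa>" using le by simp
    have "(Lp_norm Q 2 B)\<^sup>2 / (\<eta> / t) \<le> 32 * \<kappa>" using le Lp_norm_nonneg[of Q 1 A] by simp
    then have "(Lp_norm Q 2 B)\<^sup>2 \<le> 32 * \<kappa> * (\<eta> / t)" using pos_divide_le_eq[OF r] by blast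
    then have "t\<^sup>2 * (Lp_norm Q 2 B)\<^sup>2 \<le> t\<^sup>2 * (32 * \<kappa> * (\<eta> / t))" by (intro mult_left_mono) auto
    also have "\<dots> = (32 * \<kappa>) * (t * \<eta>)" using t by (simp add: power2_eq_square)
    also have "\<dots> \<le> (32 * \<kappa>) * (32 * \<kappa>)"
      using \<gamma> \<eta> t by (intro mult_left_mono) (auto simp: \<kappa>_def)
    finally have "(t * Lp_norm Q 2 B)\<^sup>2 \<le> (32 * \<kappa>)\<^sup>2" by (simp add: power2_eq_square mult_ac)
    then have B_le: "t * Lp_norm Q 2 B \<le> 32 * \<kappa>"
      by (rule power2_le_imp_le) (use \<gamma> \<eta> t in \<open>simp add: \<kappa>_def\<close>)
    have AY: "A \<in> Lp_closure Q 1 Z" "F0 \<in> Lp_closure Q 1 Z"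
      and BY: "B \<in> Lp_closure Q 2 Z" "F1 \<in> Lp_closure Q 2 Z"
      using AB(1,2) F0(1) F1(1) Lp_closure_superset[OF Z(1)] Lp_closure_superset[OF Z(2)] by blast+
    have y0: "A + (f0 - F0) \<in> Lp_closure Q 1 Z"
      by (intro fun_space.subspace_add[OF sub1] fun_space.subspace_diff[OF sub1] AY f)
    have y1: "B + (f1 - F1) \<in> Lp_closure Q 2 Z"
      by (intro fun_space.subspace_add[OF sub2] fun_space.subspace_diff[OF sub2] BY f)
    have "f0 + f1 = (A + B) - (F0 + F1) + (f0 + f1)" using AB(3) by simp
    then have "f0 + f1 = (A + (f0 - F0)) + (B + (f1 - F1))" by (simp add: algebra_simps)
    then have "?K \<le> Lp_norm Q 1 (A + (f0 - F0)) + t * Lp_norm Q 2 (B + (f1 - F1))"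
      by (rule K_functional_le[OF y0 y1]) (use t in \<open>simp_all add: Lp_norm_nonneg\<close>)
    also have "\<dots> \<le> 4 * (32 * \<kappa> + e) + t * (4 * (Lp_norm Q 2 B + e))"
    proof (intro add_mono mult_left_mono)
      have AL: "A \<in> Lp Q 1" and BL: "B \<in> Lp Q 2" using AB Z by auto
      show "Lp_norm Q 1 (A + (f0 - F0)) \<le> 4 * (32 * \<kappa> + e)"
        using Lp_add(2)[OF AL d0] A_le F0(2) by simp
      show "Lp_norm Q 2 (B + (f1 - F1)) \<le> 4 * (Lp_norm Q 2 B + e)"
        using Lp_add(2)[OF BL d1] F1(2) by simp
    qed (use t in simp)
    also have "\<dots> = 4 * (32 * \<kappa> + e) + 4 * (t * Lp_norm Q 2 B + t * e)" by (simp add: algebra_simps)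
    also have "\<dots> \<le> 4 * (32 * \<kappa> + e) + 4 * (32 * \<kappa> + t * e)" using B_le by simp
    also have "\<dots> = 1024 * (Lp_norm Q 1 g + t * Lp_norm Q 2 h) + 1028 * ((1 + t) * e)"
      by (simp add: \<kappa>_def \<gamma>_def \<eta>_def algebra_simps)
    finally show ?thesis .
  qed
  show ?thesis
  proof (rule field_le_epsilon)
    fix d :: real assume d: "0 < d"
    define e where "e = d / 1028 / (1 + t)"
    have "0 < e" unfolding e_def using d t by (intro divide_pos_pos) auto
    have "(1 + t) * e = d / 1028"
      unfolding e_def by (subst times_divide_eq_right, rule nonzero_mult_div_cancel_left) (use t in simp)
    then have "1028 * ((1 + t) * e) = d" by simp
    with bound[OF \<open>0 < e\<close>] show "?K \<le> 1024 * (Lp_norm Q 1 g + t * Lp_norm Q 2 h) + d"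
      by (simp only:)
  qed
qed

theorem theorem6p1:
  fixes M :: "'a measure"
  assumes "prob_space M"
  shows "K_closed
    (U1_1_vec M lborel :: ((nat \<Rightarrow> 'a) \<times> real \<Rightarrow> 'k::{real_normed_field, euclidean_space}) set)
    (U2_1_vec M lborel)
    (Bochner (infinite_power M) lborel 1) (Bochner_norm (infinite_power M) lborel 1)
    (Bochner (infinite_power M) lborel 2) (Bochner_norm (infinite_power M) lborel 2)"
proof -
  let ?P = "infinite_power M"
  let ?N = "lborel :: real measure"
  let ?Q = "?P \<Otimes>\<^sub>M ?N"
  let ?F = "first_order_sums M :: ((nat \<Rightarrow> 'a) \<Rightarrow> 'k) set"
  let ?Z = "simple_sections M ?N :: ((nat \<Rightarrow> 'a) \<times> real \<Rightarrow> 'k) set"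
  interpret prob_space M by fact
  interpret P: prob_space ?P by (rule prob_space_infinite_power) fact
  note sf = P.sigma_finite_measure_axioms lborel.sigma_finite_measure_axioms
  have N: "space ?N = UNIV" by simp
  \<comment> \<open>One density argument serves both exponents.\<close>
  have vec: "closure_in (Bochner ?P ?N p) (Bochner_norm ?P ?N p) (tensor U (Lp ?N p)) = Lp_closure ?Q p ?Z"
    and ZL: "?Z \<subseteq> Lp ?Q p"
    if p: "1 \<le> p" and U: "?F \<subseteq> U" "U \<subseteq> Lp_closure ?P p ?F" and F: "?F \<subseteq> Lp ?P p"
    for p and U :: "((nat \<Rightarrow> 'a) \<Rightarrow> 'k) set"
  proof -
    have UL: "U \<subseteq> Lp ?P p" using U(2) Lp_closure_subset by blast
    note T = tensor_subset_Lp[OF sf p UL]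
    have ZT: "?Z \<subseteq> tensor U (Lp ?N p)"
      using p by (intro simple_sections_subset_tensor N U) simp
    then show Z: "?Z \<subseteq> Lp ?Q p" using T by blast
    have "Lp_closure ?Q p (tensor U (Lp ?N p)) = Lp_closure ?Q p ?Z"
    proof
      show "Lp_closure ?Q p (tensor U (Lp ?N p)) \<subseteq> Lp_closure ?Q p ?Z"
        by (intro Lp_closure_minimal Z p tensor_subset_closure_simple_sections sf N F U)
      show "Lp_closure ?Q p ?Z \<subseteq> Lp_closure ?Q p (tensor U (Lp ?N p))"
        using ZT Lp_closure_superset[OF T] by (intro Lp_closure_minimal T p) blast
    qed
    then show "closure_in (Bochner ?P ?N p) (Bochner_norm ?P ?N p) (tensor U (Lp ?N p)) = Lp_closure ?Q p ?Z"
      by (simp add: closure_in_Bochner[OF sf p T])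
  qed
  have F1: "?F \<subseteq> U1_1 M" unfolding U1_1_eq by (rule Lp_closure_superset[OF first_order_sums_subset_Lp1])
  have U1: "U1_1_vec M ?N = Lp_closure ?Q 1 ?Z"
    unfolding U1_1_vec_def by (rule vec[OF _ F1]) (simp_all add: U1_1_eq first_order_sums_subset_Lp1)
  have U2: "U2_1_vec M ?N = Lp_closure ?Q 2 ?Z"
    unfolding U2_1_vec_def
    by (rule vec[OF _ first_order_sums_subset_U2_1 U2_1_subset_closure first_order_sums_subset_Lp2]) simp
  have Z1: "?Z \<subseteq> Lp ?Q 1" by (rule ZL[OF _ F1]) (simp_all add: U1_1_eq first_order_sums_subset_Lp1)
  have Z2: "?Z \<subseteq> Lp ?Q 2"
    by (rule ZL[OF _ first_order_sums_subset_U2_1 U2_1_subset_closure first_order_sums_subset_Lp2]) simp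
  have B: "Bochner ?P ?N 1 = (Lp ?Q 1 :: ((nat \<Rightarrow> 'a) \<times> real \<Rightarrow> 'k) set)"
    "Bochner ?P ?N 2 = (Lp ?Q 2 :: ((nat \<Rightarrow> 'a) \<times> real \<Rightarrow> 'k) set)"
    by (simp_all add: Bochner_eq_Lp[OF sf])
  have Bn: "Bochner_norm ?P ?N 1 f = Lp_norm ?Q 1 f" if "f \<in> Lp ?Q 1" for f :: "(nat \<Rightarrow> 'a) \<times> real \<Rightarrow> 'k"
    using that by (intro Bochner_norm_eq_Lp_norm[OF sf]) auto
  have Bn': "Bochner_norm ?P ?N 2 f = Lp_norm ?Q 2 f" if "f \<in> Lp ?Q 2" for f :: "(nat \<Rightarrow> 'a) \<times> real \<Rightarrow> 'k"
    using that by (intro Bochner_norm_eq_Lp_norm[OF sf]) auto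
  have K: "K_functional (Lp_closure ?Q 1 ?Z) (Bochner_norm ?P ?N 1) (Lp_closure ?Q 2 ?Z) (Bochner_norm ?P ?N 2) f t
      = K_functional (Lp_closure ?Q 1 ?Z) (Lp_norm ?Q 1) (Lp_closure ?Q 2 ?Z) (Lp_norm ?Q 2) f t" for f t
    by (rule K_functional_cong) (auto simp: Bn Bn' closure_in_def)
  show ?thesis
    unfolding U1 U2 B
  proof (rule K_closedI[where C = 1024])
    show "Lp_closure ?Q 1 ?Z \<subseteq> Lp ?Q 1" "Lp_closure ?Q 2 ?Z \<subseteq> Lp ?Q 2" by (rule Lp_closure_subset)+
    fix f0 f1 g h :: "(nat \<Rightarrow> 'a) \<times> real \<Rightarrow> 'k" and t :: real
    assume f: "f0 \<in> Lp_closure ?Q 1 ?Z" "f1 \<in> Lp_closure ?Q 2 ?Z"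
      and gh: "g \<in> Lp ?Q 1" "h \<in> Lp ?Q 2" "f0 + f1 = g + h" and t: "0 < t"
    show "K_functional (Lp_closure ?Q 1 ?Z) (Bochner_norm ?P ?N 1) (Lp_closure ?Q 2 ?Z)
        (Bochner_norm ?P ?N 2) (f0 + f1) t \<le> 1024 * (Bochner_norm ?P ?N 1 g + t * Bochner_norm ?P ?N 2 h)"
      unfolding K Bn[OF gh(1)] Bn'[OF gh(2)]
      by (rule K_functional_closure_simple_sections[OF sf(2) N Z1 Z2 f gh t])
  qed simp
qed

end
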